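(* Let $\overline{\mathcal G}$ be the group of interval exchange transformations with flips of $[0,1)$ (modulo equality outside finite sets). Any element of $\overline{\mathcal G}$ is the product of at most $12$ involutions in $\overline{\mathcal G}$.
   Context: Let $I=[0,1)$. An interval exchange transformation with flips (FIET) on $I$ is a bijection $f:I\to I$ for which there is a subdivision $0=a_1<\cdots<a_m<a_{m+1}=1$ such that each restriction $f|_{(a_i,a_{i+1})}$ is a continuous isometry (orientation preserving or orientation reversing). Two FIET $f,g$ are equivalent if $\{x\in I: f(x)\neq g(x)\}$ is finite. $\overline{\mathcal G}$ denotes the group of equivalence classes of FIET on $I$ under composition (the quotient of the FIET group by the normal subgroup of elements that are the identity except possibly at finitely many points). *)

theory Defs
  imports Complex_Main "HOL-Algebra.Bij" "HOL-Algebra.Coset"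
begin

definition is_fiet :: "(real \<Rightarrow> real) \<Rightarrow> bool" where
  "is_fiet f \<longleftrightarrow> bij_betw f {0..<1} {0..<1} \<and>
     (\<exists>(m::nat) (a::nat \<Rightarrow> real). a 1 = 0 \<and> a (m + 1) = 1 \<and>
        (\<forall>i\<in>{1..m}. a i < a (i + 1) \<and>
           continuous_on {a i<..<a (i + 1)} f \<and>
           (\<forall>x\<in>{a i<..<a (i + 1)}. \<forall>y\<in>{a i<..<a (i + 1)}. dist (f x) (f y) = dist x y)))"

text \<open>As in \<^const>\<open>BijGroup\<close>, maps of \<open>[0,1)\<close> are represented by extensional functions,
  so that equality in the carrier is equality on \<open>[0,1)\<close>.\<close>

definition FIET :: "(real \<Rightarrow> real) monoid" where
  "FIET = BijGroup {0..<1} \<lparr>carrier := {f \<in> Bij {0..<1}. is_fiet f}\<rparr>"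

definition FIET_null :: "(real \<Rightarrow> real) set" where
  "FIET_null = {f \<in> carrier FIET. finite {x \<in> {0..<1}. f x \<noteq> x}}"

definition FIET_bar :: "(real \<Rightarrow> real) set monoid" where
  "FIET_bar = FIET Mod FIET_null"

definition involution :: "('a, 'b) monoid_scheme \<Rightarrow> 'a \<Rightarrow> bool" where
  "involution G s \<longleftrightarrow> s \<in> carrier G \<and> s \<noteq> \<one>\<^bsub>G\<^esub> \<and> s \<otimes>\<^bsub>G\<^esub> s = \<one>\<^bsub>G\<^esub>"


section \<open>The FIETs form a group and \<open>FIET_null\<close> is a normal subgroup\<close>

definition pw_iso :: "(real \<Rightarrow> real) \<Rightarrow> real set \<Rightarrow> bool" where
  "pw_iso f F \<longleftrightarrow> (\<forall>x y. x \<le> y \<longrightarrow> {x..y} \<subseteq> {0..<1} - F \<longrightarrow> \<bar>f x - f y\<bar> = y - x)"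

lemma is_fiet_imp_pw_iso:
  assumes "is_fiet f"
  obtains F where "finite F" "pw_iso f F"
proof -
  obtain m :: nat and a :: "nat \<Rightarrow> real" where a: "a 1 = 0" "a (m + 1) = 1"
    and iso: "\<And>i x y. i \<in> {1..m} \<Longrightarrow> x \<in> {a i<..<a (i + 1)} \<Longrightarrow> y \<in> {a i<..<a (i + 1)}
                 \<Longrightarrow> dist (f x) (f y) = dist x y"
    using assms unfolding is_fiet_def by metis
  have m: "1 \<le> m" using a by (cases m) auto
  have "pw_iso f (a ` {1..m})"
    unfolding pw_iso_def
  proof (intro allI impI)
    fix x y :: real assume xy: "x \<le> y" "{x..y} \<subseteq> {0..<1} - a ` {1..m}"
    define S where "S = {i \<in> {1..m}. a i \<le> x}"
    have x0: "0 \<le> x" "y < 1" using xy by auto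
    have S: "finite S" "S \<noteq> {}" using a m x0 by (auto simp: S_def)
    define i where "i = Max S"
    have iS: "i \<in> S" unfolding i_def using S by (rule Max_in)
    have i: "i \<in> {1..m}" "a i \<le> x" using iS by (auto simp: S_def)
    have "a i \<noteq> x" using i xy by auto
    then have 1: "a i < x" using i by simp
    have 2: "y < a (i + 1)"
    proof (cases "i = m")
      case True then show ?thesis using a x0 by simp
    next
      case False
      then have im: "i + 1 \<in> {1..m}" using i by auto
      have "i + 1 \<notin> S" using Max_ge[OF S(1), of "i + 1"] by (auto simp: i_def)
      then have "x < a (i + 1)" using im by (auto simp: S_def)
      moreover have "a (i + 1) \<notin> {x..y}" using im xy by blast
      ultimately show ?thesis by auto
    qed
    have "dist (f x) (f y) = dist x y"
      using 1 2 xy(1) by (intro iso[OF i(1)]) auto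
    then show "\<bar>f x - f y\<bar> = y - x" using xy(1) by (simp add: dist_real_def)
  qed
  then show thesis by (intro that[of "a ` {1..m}"]) auto
qed

lemma isometric_imp_continuous_on:
  fixes f :: "real \<Rightarrow> real"
  assumes "\<And>x y. x \<in> S \<Longrightarrow> y \<in> S \<Longrightarrow> dist (f x) (f y) = dist x y"
  shows "continuous_on S f"
  unfolding continuous_on_def
proof
  fix x assume x: "x \<in> S"
  show "(f \<longlongrightarrow> f x) (at x within S)"
    using assms[OF _ x] by (auto intro!: tendstoI simp: eventually_at)
qed

lemma pw_iso_imp_is_fiet:
  assumes bij: "bij_betw f {0..<1} {0..<1}" and F: "finite F" "pw_iso f F"
  shows "is_fiet f"
proof -
  define A where "A = insert 0 (insert 1 (F \<inter> {0..1}))"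
  define L where "L = sorted_list_of_set A"
  define n where "n = length L"
  have A: "finite A" "0 \<in> A" "1 \<in> A" "A \<subseteq> {0..1}" using F by (auto simp: A_def)
  have setL: "set L = A" and srt: "sorted_wrt (<) L"
    using A by (auto simp: L_def)
  have mono: "L ! i < L ! j" if "i < j" "j < n" for i j
    using srt that by (auto simp: sorted_wrt_iff_nth_less n_def)
  have mem: "L ! i \<in> A" if "i < n" for i using that setL by (auto simp: n_def)
  have memI: "\<exists>i<n. L ! i = c" if "c \<in> A" for c
    using that setL by (auto simp: n_def in_set_conv_nth)
  obtain i0 i1 where i0: "i0 < n" "L ! i0 = 0" and i1: "i1 < n" "L ! i1 = 1"
    using memI A by meson
  have n2: "n \<ge> 2" using i0 i1 by (cases "i0 = i1") auto
  have i00: "i0 = 0" using mono[of 0 i0] mem[of 0] A i0 n2 by (cases i0) force+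
  have i11: "i1 = n - 1"
  proof (rule ccontr)
    assume "i1 \<noteq> n - 1"
    then have "L ! i1 < L ! (n - 1)" using i1 n2 by (intro mono) auto
    moreover have "L ! (n - 1) \<le> 1" using mem[of "n - 1"] A n2 by auto
    ultimately show False using i1 by simp
  qed
  have step: "L ! (i - 1) < L ! i"
    "\<And>x y. x \<in> {L ! (i - 1)<..<L ! i} \<Longrightarrow> y \<in> {L ! (i - 1)<..<L ! i}
        \<Longrightarrow> dist (f x) (f y) = dist x y"
    if i: "i \<in> {1..n - 1}" for i
  proof -
    show "L ! (i - 1) < L ! i" using i n2 by (intro mono) auto
    have sub: "{L ! (i - 1)<..<L ! i} \<subseteq> {0..<1} - F"
    proof
      fix z assume z: "z \<in> {L ! (i - 1)<..<L ! i}"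
      have "L ! (i - 1) \<in> A" "L ! i \<in> A" using i n2 by (intro mem; auto)+
      then have z1: "0 \<le> z" "z < 1" using z A by force+
      have "z \<notin> F"
      proof
        assume "z \<in> F"
        then have "z \<in> A" using z1 by (auto simp: A_def)
        then obtain j where j: "j < n" "L ! j = z" using memI by blast
        consider "j < i - 1" | "j = i - 1" | "j = i" | "i < j" using i by force
        then show False
        proof cases
          case 1
          have "i - 1 < n" using i n2 by auto
          then show False using mono[of j "i - 1"] 1 j z by auto
        next
          case 4 then show False using mono[of i j] j z by auto
        qed (use j z in auto)
      qed
      then show "z \<in> {0..<1} - F" using z1 by auto
    qed
    have le: "dist (f x) (f y) = dist x y"
      if "x \<in> {L ! (i - 1)<..<L ! i}" "y \<in> {L ! (i - 1)<..<L ! i}" "x \<le> y" for x y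
    proof -
      have "{x..y} \<subseteq> {L ! (i - 1)<..<L ! i}" using that by auto
      then have "\<bar>f x - f y\<bar> = y - x" using F(2) sub that(3) unfolding pw_iso_def by blast
      then show ?thesis using that(3) by (simp add: dist_real_def)
    qed
    show "dist (f x) (f y) = dist x y"
      if "x \<in> {L ! (i - 1)<..<L ! i}" "y \<in> {L ! (i - 1)<..<L ! i}" for x y
      using le[of x y] le[of y x] that by (cases "x \<le> y") (auto simp: dist_commute)
  qed
  define a where "a i = L ! (i - 1)" for i
  have "a 1 = 0" "a ((n - 1) + 1) = 1" using i0 i1 i00 i11 n2 by (auto simp: a_def)
  moreover have "\<forall>i\<in>{1..n - 1}. a i < a (i + 1) \<and> continuous_on {a i<..<a (i + 1)} f \<and>
      (\<forall>x\<in>{a i<..<a (i + 1)}. \<forall>y\<in>{a i<..<a (i + 1)}. dist (f x) (f y) = dist x y)"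
    using step unfolding a_def
    by (auto intro!: isometric_imp_continuous_on)
  ultimately show ?thesis unfolding is_fiet_def using bij by blast
qed

lemma pw_iso_interval:
  assumes g: "pw_iso g F" and uv: "{u..v} \<subseteq> {0..<1} - F"
  shows "x \<in> {u..v} \<Longrightarrow> y \<in> {u..v} \<Longrightarrow> dist (g x) (g y) = dist x y"
    and "connected (g ` {u..v})"
proof -
  have le: "dist (g x) (g y) = dist x y" if "x \<in> {u..v}" "y \<in> {u..v}" "x \<le> y" for x y
  proof -
    have "{x..y} \<subseteq> {u..v}" using that by auto
    then have "\<bar>g x - g y\<bar> = y - x" using g uv that(3) unfolding pw_iso_def by blast
    then show ?thesis using that(3) by (simp add: dist_real_def)
  qed
  have iso: "dist (g x) (g y) = dist x y" if "x \<in> {u..v}" "y \<in> {u..v}" for x y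
    using le[of x y] le[of y x] that by (cases "x \<le> y") (auto simp: dist_commute)
  then show "x \<in> {u..v} \<Longrightarrow> y \<in> {u..v} \<Longrightarrow> dist (g x) (g y) = dist x y" .
  show "connected (g ` {u..v})"
    by (intro connected_continuous_image isometric_imp_continuous_on iso) auto
qed

lemma is_fiet_cong:
  assumes "\<And>x. x \<in> {0..<1} \<Longrightarrow> f x = g x" "is_fiet f"
  shows "is_fiet g"
proof -
  obtain F where F: "finite F" "pw_iso f F" using is_fiet_imp_pw_iso[OF assms(2)] .
  have "pw_iso g F"
    unfolding pw_iso_def
  proof (intro allI impI)
    fix x y :: real assume xy: "x \<le> y" "{x..y} \<subseteq> {0..<1} - F"
    then have "x \<in> {0..<1}" "y \<in> {0..<1}" by auto
    then have "f x = g x" "f y = g y" using assms(1) by blast+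
    then show "\<bar>g x - g y\<bar> = y - x" using F(2) xy unfolding pw_iso_def by metis
  qed
  moreover have "bij_betw g {0..<1} {0..<1}"
    using assms bij_betw_cong[of "{0..<1}" f g] unfolding is_fiet_def by blast
  ultimately show ?thesis using pw_iso_imp_is_fiet F(1) by blast
qed

lemma is_fiet_compose:
  assumes "is_fiet f" "is_fiet g"
  shows "is_fiet (f \<circ> g)"
proof -
  have bf: "bij_betw f {0..<1} {0..<1}" and bg: "bij_betw g {0..<1} {0..<1}"
    using assms by (auto simp: is_fiet_def)
  obtain Ff where Ff: "finite Ff" "pw_iso f Ff" using is_fiet_imp_pw_iso[OF assms(1)] .
  obtain Fg where Fg: "finite Fg" "pw_iso g Fg" using is_fiet_imp_pw_iso[OF assms(2)] .
  define F where "F = Fg \<union> (g -` Ff \<inter> {0..<1})"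
  have "finite F"
    using Ff Fg bg by (auto simp: F_def bij_betw_def intro!: finite_vimage_IntI)
  moreover have "pw_iso (f \<circ> g) F"
    unfolding pw_iso_def
  proof (intro allI impI)
    fix x y :: real assume xy: "x \<le> y" "{x..y} \<subseteq> {0..<1} - F"
    have sub: "{x..y} \<subseteq> {0..<1} - Fg" using xy by (auto simp: F_def)
    have im: "g ` {x..y} \<subseteq> {0..<1} - Ff"
      using xy bg by (fastforce simp: F_def bij_betw_def)
    note g = pw_iso_interval[OF Fg(2) sub]
    have d: "\<bar>g x - g y\<bar> = y - x" using g(1)[of x y] xy by (simp add: dist_real_def)
    have in1: "g x \<in> g ` {x..y}" "g y \<in> g ` {x..y}" using xy(1) by auto
    show "\<bar>(f \<circ> g) x - (f \<circ> g) y\<bar> = y - x"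
    proof (cases "g x \<le> g y")
      case True
      have "{g x..g y} \<subseteq> g ` {x..y}" using in1 by (intro connected_contains_Icc g(2))
      then have "\<bar>f (g x) - f (g y)\<bar> = g y - g x"
        using Ff(2) im True unfolding pw_iso_def by blast
      then show ?thesis using d True by simp
    next
      case False
      then have le: "g y \<le> g x" by simp
      have "{g y..g x} \<subseteq> g ` {x..y}" using in1 by (intro connected_contains_Icc g(2))
      then have "\<bar>f (g y) - f (g x)\<bar> = g x - g y"
        using Ff(2) im le unfolding pw_iso_def by blast
      then show ?thesis using d le by simp
    qed
  qed
  moreover have "bij_betw (f \<circ> g) {0..<1} {0..<1}" using bij_betw_trans[OF bg bf] .
  ultimately show ?thesis using pw_iso_imp_is_fiet by blast
qed

lemma pw_iso_open_image:
  assumes f: "pw_iso f F" and W: "open W" "W \<subseteq> {0..<1} - F"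
  shows "open (f ` W)"
  unfolding open_dist
proof (intro ballI)
  fix z assume "z \<in> f ` W"
  then obtain w where w: "w \<in> W" "z = f w" by auto
  obtain e where e: "e > 0" "\<And>y. dist y w < e \<Longrightarrow> y \<in> W"
    using W(1) w(1) unfolding open_dist by blast
  define d where "d = e / 2"
  have d: "d > 0" "{w - d..w + d} \<subseteq> W"
    using e by (auto simp: d_def dist_real_def)
  have sub: "{w - d..w + d} \<subseteq> {0..<1} - F" using d W by blast
  note fi = pw_iso_interval[OF f sub]
  have 1: "\<bar>f (w - d) - f w\<bar> = d" "\<bar>f (w + d) - f w\<bar> = d"
    "\<bar>f (w - d) - f (w + d)\<bar> = 2 * d"
    using fi(1)[of "w - d" w] fi(1)[of "w + d" w] fi(1)[of "w - d" "w + d"] d(1)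
    by (auto simp: dist_real_def)
  have in1: "f (w - d) \<in> f ` {w - d..w + d}" "f (w + d) \<in> f ` {w - d..w + d}"
    using d(1) by auto
  have "{f w - d..f w + d} \<subseteq> f ` {w - d..w + d}"
  proof (cases "f (w - d) \<le> f (w + d)")
    case True
    then have "f (w - d) = f w - d" "f (w + d) = f w + d" using 1 d(1) by linarith+
    then show ?thesis using connected_contains_Icc[OF fi(2) in1] by simp
  next
    case False
    then have "f (w - d) = f w + d" "f (w + d) = f w - d" using 1 d(1) by linarith+
    then show ?thesis using connected_contains_Icc[OF fi(2) in1(2,1)] by simp
  qed
  then have "{f w - d..f w + d} \<subseteq> f ` W" using d(2) by blast
  then show "\<exists>e>0. \<forall>y. dist y z < e \<longrightarrow> y \<in> f ` W"
    using d(1) w(2) by (intro exI[of _ d]) (force simp: dist_real_def)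
qed

lemma is_fiet_inv_into:
  assumes "is_fiet f"
  shows "is_fiet (inv_into {0..<1} f)"
proof -
  let ?h = "inv_into {0..<1} f"
  have bf: "bij_betw f {0..<1} {0..<1}" using assms by (auto simp: is_fiet_def)
  have bh: "bij_betw ?h {0..<1} {0..<1}" using bf by (rule bij_betw_inv_into)
  have fh: "f (?h u) = u" if "u \<in> {0..<1}" for u
    using bf that by (simp add: bij_betw_inv_into_right)
  have inj: "inj_on f {0..<1}" using bf by (simp add: bij_betw_def)
  have hI: "?h u \<in> {0..<1}" if "u \<in> {0..<1}" for u
    using bh that by (auto simp: bij_betw_def)
  obtain F where F: "finite F" "pw_iso f F" using is_fiet_imp_pw_iso[OF assms] .
  define F0 where "F0 = insert 0 F"
  have F0: "finite F0" "closed F0" using F by (auto simp: F0_def intro!: finite_imp_closed)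
  have pF0: "pw_iso f F0" using F(2) unfolding pw_iso_def F0_def by blast
  have "pw_iso ?h (f ` F0)"
    unfolding pw_iso_def
  proof (intro allI impI)
    fix u v :: real assume uv: "u \<le> v" "{u..v} \<subseteq> {0..<1} - f ` F0"
    have uvI: "u \<in> {0..<1}" "v \<in> {0..<1}" using uv by auto
    have hF: "?h z \<in> {0..<1} - F0" if "z \<in> {u..v}" for z
    proof -
      have "z \<in> {0..<1}" "z \<notin> f ` F0" using uv that by blast+
      then show ?thesis using hI[of z] fh[of z] by (metis DiffI image_eqI)
    qed
    have nosep: "c \<notin> F0" if c: "min (?h u) (?h v) \<le> c" "c \<le> max (?h u) (?h v)" for c
    proof
      assume cF: "c \<in> F0"
      have cI: "c \<in> {0..<1}"
        using c hI[OF uvI(1)] hI[OF uvI(2)]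
        by (simp only: min_def max_def atLeastLessThan_iff split: if_splits) linarith+
      define U where "U = f ` ({0<..<c} - F0)"
      define V where "V = f ` ({c<..<1} - F0)"
      have sub: "{0<..<c} - F0 \<subseteq> {0..<1} - F0" "{c<..<1} - F0 \<subseteq> {0..<1} - F0"
        using cI by auto
      have oU: "open U" "open V" unfolding U_def V_def
        using sub F0 by (auto intro!: pw_iso_open_image[OF pF0] open_Diff)
      have dis: "U \<inter> V = {}"
        unfolding U_def V_def
        by (subst inj_on_image_Int[OF inj, symmetric]) (use sub in auto)
      have side: "z \<in> U \<longleftrightarrow> ?h z < c" "z \<in> V \<longleftrightarrow> c < ?h z" "z \<in> U \<union> V"
        if z: "z \<in> {u..v}" for z
      proof -
        have h: "?h z \<in> {0..<1}" "?h z \<notin> F0" using hF[OF z] by auto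
        have nz: "?h z \<noteq> 0" "?h z \<noteq> c" using h cF by (auto simp: F0_def)
        have zf: "z = f (?h z)" using z uv by (intro fh[symmetric]) blast
        have U: "z \<in> U" if "?h z < c"
          unfolding U_def using h nz that by (subst zf, intro imageI) auto
        have V: "z \<in> V" if "c < ?h z"
          unfolding V_def using h nz that by (subst zf, intro imageI) auto
        show "z \<in> U \<longleftrightarrow> ?h z < c" "z \<in> V \<longleftrightarrow> c < ?h z" "z \<in> U \<union> V"
          using U V nz(2) dis by (cases "?h z" c rule: linorder_cases; auto)+
      qed
      have uv1: "u \<in> {u..v}" "v \<in> {u..v}" using uv(1) by auto
      have "U \<inter> {u..v} \<noteq> {} \<and> V \<inter> {u..v} \<noteq> {}"
      proof -
        have "?h u \<noteq> c" "?h v \<noteq> c" using hF[OF uv1(1)] hF[OF uv1(2)] cF by auto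
        then have "?h u < c \<and> c < ?h v \<or> ?h v < c \<and> c < ?h u"
          using c by (simp only: min_def max_def split: if_splits) linarith+
        then show ?thesis using side(1,2)[OF uv1(1)] side(1,2)[OF uv1(2)] uv1 by blast
      qed
      moreover have "{u..v} \<subseteq> U \<union> V" using side(3) by blast
      moreover have "U \<inter> V \<inter> {u..v} = {}" using dis by blast
      ultimately show False
        using connectedD[OF connected_Icc[of u v] oU] by blast
    qed
    have *: "\<bar>f (min (?h u) (?h v)) - f (max (?h u) (?h v))\<bar> = max (?h u) (?h v) - min (?h u) (?h v)"
    proof -
      have "{min (?h u) (?h v)..max (?h u) (?h v)} \<subseteq> {0..<1} - F0"
      proof
        fix c assume "c \<in> {min (?h u) (?h v)..max (?h u) (?h v)}"
        then have c: "min (?h u) (?h v) \<le> c" "c \<le> max (?h u) (?h v)" by simp_all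
        then have "0 \<le> c" "c < 1"
          using hI[OF uvI(1)] hI[OF uvI(2)]
          by (simp only: min_def max_def atLeastLessThan_iff split: if_splits; linarith)+
        then show "c \<in> {0..<1} - F0" using nosep[OF c] by simp
      qed
      moreover have "min (?h u) (?h v) \<le> max (?h u) (?h v)" by simp
      ultimately show ?thesis using pF0 unfolding pw_iso_def by blast
    qed
    show "\<bar>?h u - ?h v\<bar> = v - u"
      using * fh[OF uvI(1)] fh[OF uvI(2)] uv(1)
      by (cases "?h u \<le> ?h v") (simp_all add: min_absorb1 min_absorb2 max_absorb1 max_absorb2)
  qed
  then show ?thesis using pw_iso_imp_is_fiet[OF bh] F0 by blast
qed

lemma is_fiet_id: "is_fiet (\<lambda>x\<in>{0..<1}. x)"
proof (rule pw_iso_imp_is_fiet)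
  show "pw_iso (\<lambda>x\<in>{0..<1}. x) {}"
    unfolding pw_iso_def
  proof (intro allI impI)
    fix x y :: real assume "x \<le> y" "{x..y} \<subseteq> {0..<1} - {}"
    then have "x \<in> {0..<1}" "y \<in> {0..<1}" "x \<le> y" by auto
    then show "\<bar>(\<lambda>x\<in>{0..<1}. x) x - (\<lambda>x\<in>{0..<1}. x) y\<bar> = y - x" by simp
  qed
  show "bij_betw (\<lambda>x\<in>{0..<1}. x) {0..<1} {0..<1::real}" using id_Bij by (auto simp: Bij_def)
qed auto

lemma subgroup_FIET: "subgroup {f \<in> Bij {0..<1}. is_fiet f} (BijGroup {0..<1})"
proof (rule subgroup.intro)
  fix f g assume fg: "f \<in> {f \<in> Bij {0..<1}. is_fiet f}" "g \<in> {f \<in> Bij {0..<1}. is_fiet f}"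
  then have "is_fiet (f \<circ> g)" by (simp add: is_fiet_compose)
  then have "is_fiet (compose {0..<1} f g)" by (rule is_fiet_cong[rotated]) (simp add: compose_eq)
  then show "f \<otimes>\<^bsub>BijGroup {0..<1}\<^esub> g \<in> {f \<in> Bij {0..<1}. is_fiet f}"
    using fg by (simp add: BijGroup_def compose_Bij)
next
  fix f assume f: "f \<in> {f \<in> Bij {0..<1}. is_fiet f}"
  then have "is_fiet (inv_into {0..<1} f)" by (simp add: is_fiet_inv_into)
  then have "is_fiet (restrict (inv_into {0..<1} f) {0..<1})" by (rule is_fiet_cong[rotated]) simp
  then show "inv\<^bsub>BijGroup {0..<1}\<^esub> f \<in> {f \<in> Bij {0..<1}. is_fiet f}"
    using f by (simp add: inv_BijGroup restrict_inv_into_Bij del: restrict_apply)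
qed (auto simp: BijGroup_def id_Bij is_fiet_id)

lemma group_FIET: "group FIET"
  unfolding FIET_def by (rule subgroup.subgroup_is_group[OF subgroup_FIET group_BijGroup])

lemma carrier_FIET: "carrier FIET = {f \<in> Bij {0..<1}. is_fiet f}"
  by (simp add: FIET_def)

lemma one_FIET: "\<one>\<^bsub>FIET\<^esub> = (\<lambda>x\<in>{0..<1}. x)"
  by (simp add: FIET_def BijGroup_def)

lemma mult_FIET:
  "f \<in> carrier FIET \<Longrightarrow> g \<in> carrier FIET \<Longrightarrow> f \<otimes>\<^bsub>FIET\<^esub> g = compose {0..<1} f g"
  by (simp add: FIET_def BijGroup_def)

lemma inv_FIET: "f \<in> carrier FIET \<Longrightarrow> inv\<^bsub>FIET\<^esub> f = (\<lambda>x\<in>{0..<1}. inv_into {0..<1} f x)"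
  using group.m_inv_consistent[OF group_BijGroup subgroup_FIET, of f]
  by (simp add: FIET_def inv_BijGroup)

lemma bij_FIET: "f \<in> carrier FIET \<Longrightarrow> bij_betw f {0..<1} {0..<1}"
  by (auto simp: carrier_FIET Bij_def)

lemma finite_preimage_FIET:
  assumes "f \<in> carrier FIET" "finite {x \<in> {0..<1}. P x}"
  shows "finite {x \<in> {0..<1}. P (f x)}"
proof -
  have b: "inj_on f {0..<1}" "f ` {0..<1} = {0..<1}"
    using bij_FIET[OF assms(1)] by (auto simp: bij_betw_def)
  have "{x \<in> {0..<1}. P (f x)} \<subseteq> f -` {x \<in> {0..<1}. P x} \<inter> {0..<1}"
    using b(2) by blast
  then show ?thesis using finite_vimage_IntI[OF assms(2) b(1)] finite_subset by blast
qed

lemma mult_inv_FIET: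
  assumes f: "f \<in> carrier FIET" and g: "g \<in> carrier FIET"
  shows "f \<otimes>\<^bsub>FIET\<^esub> inv\<^bsub>FIET\<^esub> g \<in> FIET_null \<longleftrightarrow> finite {x \<in> {0..<1}. f x \<noteq> g x}"
proof -
  interpret group FIET by (rule group_FIET)
  let ?k = "f \<otimes>\<^bsub>FIET\<^esub> inv\<^bsub>FIET\<^esub> g"
  have k: "?k \<in> carrier FIET" using f g by simp
  have kg: "?k (g x) = f x" if "x \<in> {0..<1}" for x
  proof -
    have "?k \<otimes>\<^bsub>FIET\<^esub> g = f" using f g by (simp add: m_assoc)
    then have "compose {0..<1} ?k g = f" using mult_FIET[OF k g] by simp
    then show ?thesis using that by (metis compose_eq)
  qed
  have gg: "?k x = f ((inv\<^bsub>FIET\<^esub> g) x)" "g ((inv\<^bsub>FIET\<^esub> g) x) = x" if "x \<in> {0..<1}" for x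
  proof -
    show "?k x = f ((inv\<^bsub>FIET\<^esub> g) x)" using f g that by (simp add: mult_FIET compose_eq)
    have "compose {0..<1} g (inv\<^bsub>FIET\<^esub> g) x = \<one>\<^bsub>FIET\<^esub> x"
      using g r_inv[OF g] by (simp add: mult_FIET)
    then show "g ((inv\<^bsub>FIET\<^esub> g) x) = x" using that by (simp add: compose_eq one_FIET)
  qed
  show ?thesis
  proof
    assume "?k \<in> FIET_null"
    then have "finite {x \<in> {0..<1}. ?k x \<noteq> x}" by (simp add: FIET_null_def)
    then have "finite {x \<in> {0..<1}. ?k (g x) \<noteq> g x}"
      using finite_preimage_FIET[OF g, of "\<lambda>y. ?k y \<noteq> y"] by simp
    moreover have "{x \<in> {0..<1}. ?k (g x) \<noteq> g x} = {x \<in> {0..<1}. f x \<noteq> g x}"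
      using kg by auto
    ultimately show "finite {x \<in> {0..<1}. f x \<noteq> g x}" by simp
  next
    assume "finite {x \<in> {0..<1}. f x \<noteq> g x}"
    then have "finite {x \<in> {0..<1}. f ((inv\<^bsub>FIET\<^esub> g) x) \<noteq> g ((inv\<^bsub>FIET\<^esub> g) x)}"
      using finite_preimage_FIET[OF inv_closed[OF g], of "\<lambda>y. f y \<noteq> g y"] by simp
    moreover have "{x \<in> {0..<1}. f ((inv\<^bsub>FIET\<^esub> g) x) \<noteq> g ((inv\<^bsub>FIET\<^esub> g) x)}
        = {x \<in> {0..<1}. ?k x \<noteq> x}" using gg by auto
    ultimately show "?k \<in> FIET_null" using k by (simp add: FIET_null_def)
  qed
qed

lemma normal_FIET_null: "FIET_null \<lhd> FIET"
proof -
  interpret group FIET by (rule group_FIET)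
  have one: "\<one>\<^bsub>FIET\<^esub> \<in> FIET_null"
  proof -
    have "{x \<in> {0..<1}. \<one>\<^bsub>FIET\<^esub> x \<noteq> x} = {}" by (auto simp: one_FIET)
    then have "finite {x \<in> {0..<1}. \<one>\<^bsub>FIET\<^esub> x \<noteq> x}" by (metis finite.emptyI)
    then show ?thesis by (simp add: FIET_null_def)
  qed
  have sub: "h \<in> carrier FIET" if "h \<in> FIET_null" for h using that by (simp add: FIET_null_def)
  have fin: "finite {x \<in> {0..<1}. h x \<noteq> x}" if "h \<in> FIET_null" for h
    using that by (simp add: FIET_null_def)
  have quot: "h \<otimes>\<^bsub>FIET\<^esub> inv\<^bsub>FIET\<^esub> k \<in> FIET_null"
    if "h \<in> FIET_null" "k \<in> FIET_null" for h k
  proof -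
    have "{x \<in> {0..<1}. h x \<noteq> k x} \<subseteq> {x \<in> {0..<1}. h x \<noteq> x} \<union> {x \<in> {0..<1}. k x \<noteq> x}"
      by auto
    then have "finite {x \<in> {0..<1}. h x \<noteq> k x}"
      using fin that finite_subset by blast
    then show ?thesis using mult_inv_FIET sub that by blast
  qed
  have inv: "inv\<^bsub>FIET\<^esub> k \<in> FIET_null" if "k \<in> FIET_null" for k
    using quot[OF one that] sub[OF that] by simp
  have mult: "h \<otimes>\<^bsub>FIET\<^esub> k \<in> FIET_null" if "h \<in> FIET_null" "k \<in> FIET_null" for h k
    using quot[OF that(1) inv[OF that(2)]] sub that by simp
  have "subgroup FIET_null FIET"
    using one sub inv mult by (intro subgroup.intro) auto
  moreover have "g \<otimes>\<^bsub>FIET\<^esub> h \<otimes>\<^bsub>FIET\<^esub> inv\<^bsub>FIET\<^esub> g \<in> FIET_null"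
    if g: "g \<in> carrier FIET" and h: "h \<in> FIET_null" for g h
  proof -
    have "{x \<in> {0..<1}. (g \<otimes>\<^bsub>FIET\<^esub> h) x \<noteq> g x} \<subseteq> {x \<in> {0..<1}. h x \<noteq> x}"
      using g sub[OF h] by (auto simp: mult_FIET compose_eq)
    then have "finite {x \<in> {0..<1}. (g \<otimes>\<^bsub>FIET\<^esub> h) x \<noteq> g x}"
      using fin[OF h] finite_subset by blast
    then show ?thesis using mult_inv_FIET[of "g \<otimes>\<^bsub>FIET\<^esub> h" g] g sub[OF h] by simp
  qed
  ultimately show ?thesis by (simp add: normal_inv_iff)
qed

lemma group_FIET_bar: "group FIET_bar"
  unfolding FIET_bar_def by (rule normal.factorgroup_is_group[OF normal_FIET_null])

lemma rcos_FIET_null_eq_iff: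
  assumes f: "f \<in> carrier FIET" and g: "g \<in> carrier FIET"
  shows "FIET_null #>\<^bsub>FIET\<^esub> f = FIET_null #>\<^bsub>FIET\<^esub> g \<longleftrightarrow> finite {x \<in> {0..<1}. f x \<noteq> g x}"
proof -
  interpret group FIET by (rule group_FIET)
  have sg: "subgroup FIET_null FIET" using normal_FIET_null by (rule normal_imp_subgroup)
  have "f \<otimes>\<^bsub>FIET\<^esub> inv\<^bsub>FIET\<^esub> g \<in> FIET_null"
    if "FIET_null #>\<^bsub>FIET\<^esub> f = FIET_null #>\<^bsub>FIET\<^esub> g"
  proof -
    have "f \<in> FIET_null #>\<^bsub>FIET\<^esub> g" using rcos_self[OF f sg] that by simp
    then obtain h where h: "h \<in> FIET_null" "f = h \<otimes>\<^bsub>FIET\<^esub> g" by (auto simp: r_coset_def)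
    have "h \<in> carrier FIET" using subgroup.mem_carrier[OF sg h(1)] .
    then have "f \<otimes>\<^bsub>FIET\<^esub> inv\<^bsub>FIET\<^esub> g = h" using g h(2) by (simp add: m_assoc)
    then show ?thesis using h(1) by simp
  qed
  moreover have "FIET_null #>\<^bsub>FIET\<^esub> f = FIET_null #>\<^bsub>FIET\<^esub> g"
    if k: "f \<otimes>\<^bsub>FIET\<^esub> inv\<^bsub>FIET\<^esub> g \<in> FIET_null"
  proof -
    have "f = f \<otimes>\<^bsub>FIET\<^esub> inv\<^bsub>FIET\<^esub> g \<otimes>\<^bsub>FIET\<^esub> g" using f g by (simp add: m_assoc)
    then have "f \<in> FIET_null #>\<^bsub>FIET\<^esub> g" using k unfolding r_coset_def by blast
    then show ?thesis using repr_independence[OF _ g sg] by simp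
  qed
  ultimately show ?thesis using mult_inv_FIET[OF f g] by blast
qed

end

theory Submission
  imports Defs
begin

text \<open>Exchange transformations with flips are treated as bijections of the line that are the identity
off \<open>[0,1)\<close> and locally an isometry off a finite set of breaks.

\<^item> A map with \<open>n\<close> breaks is a product of at most \<open>2 * n + 1\<close> flips of intervals, up to finitely many
  points (\<open>flip_factor\<close>), so the number of factors depends only on \<open>n\<close>.

\<^item> If \<open>N\<close> involutions are all supported in \<open>[0,w)\<close> with \<open>w \<le> 1 / (N + 2)\<close>, then their product is a
  product of only five involutions (\<open>compress\<close>). Copies of the partial products and of their inverses
  are placed on adjacent disjoint intervals. All the factors are then used up simultaneously, on
  different intervals.

\<^item> It remains to shrink the support of a map \<open>g\<close> without making it more complicated. For a fine grid of width
  \<open>1 / q\<close>, two involutions adjust the translation lengths of the pieces of \<open>g\<close> to multiples of \<open>1 / q\<close>, up to a bounded number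
  of blocks (\<open>align_to_grid\<close>). Every bijection is the product of two involutions
  (\<open>bij_two_involutions\<close>), hence permutations of blocks are. One such permutation collects the bad blocks at the left end,
  and another one moves all the other blocks back to where they came from. What is left is supported in a
  bounded number of blocks and has a number of breaks that does not depend on \<open>q\<close>, so that for large
  \<open>q\<close> the first two items apply.

Altogether \<open>2 + 2 + 5 + 2 = 11\<close> involutions are used (\<open>piso_product_of_involutions\<close>). Factors that become trivial modulo
finite sets are dropped in the end.\<close>

text \<open>The symbol \<open>inv\<close> denotes the inverse in a group here, so inverse functions get their own name.\<close>

abbreviation finv :: "('a \<Rightarrow> 'b) \<Rightarrow> 'b \<Rightarrow> 'a" where
  "finv f \<equiv> inv_into UNIV f"

section \<open>Piecewise isometric bijections of the line\<close>

text \<open>The point \<open>x\<close> is regular for \<open>f\<close> if \<open>f\<close> is an affine isometry on a whole neighbourhood of \<open>x\<close>;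
the other points are the breaks. Complexity of a map is measured by the number of its breaks. In
contrast to a chosen subdivision, the set of breaks is determined by the map, and it behaves
well under composition and inversion. A point is a break even if redefining the map at that single
point would remove it.\<close>

definition liso :: "(real \<Rightarrow> real) \<Rightarrow> real \<Rightarrow> bool" where
  "liso f x \<longleftrightarrow> (\<exists>e t r. \<bar>e\<bar> = 1 \<and> r > 0 \<and> (\<forall>y. \<bar>y - x\<bar> < r \<longrightarrow> f y = e * y + t))"

definition breaks :: "(real \<Rightarrow> real) \<Rightarrow> real set" where
  "breaks f = {x. \<not> liso f x}"

lemma liso_intro:
  "\<bar>e\<bar> = 1 \<Longrightarrow> r > 0 \<Longrightarrow> (\<And>y. \<bar>y - x\<bar> < r \<Longrightarrow> f y = e * y + t) \<Longrightarrow> liso f x"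
  unfolding liso_def by blast

lemma liso_centered:
  assumes "liso f x"
  obtains e r where "\<bar>e\<bar> = 1" "r > 0" "\<And>y. \<bar>y - x\<bar> < r \<Longrightarrow> f y = f x + e * (y - x)"
proof -
  obtain e t r where "\<bar>e\<bar> = 1" "r > 0" and f: "\<And>y. \<bar>y - x\<bar> < r \<Longrightarrow> f y = e * y + t"
    using assms unfolding liso_def by blast
  moreover have "f y = f x + e * (y - x)" if "\<bar>y - x\<bar> < r" for y
    using f[of y] f[of x] that \<open>r > 0\<close> by (simp add: algebra_simps)
  ultimately show thesis using that by blast
qed

lemma abs_eq_1_cases: "\<bar>e::real\<bar> = 1 \<Longrightarrow> (e = 1 \<Longrightarrow> P) \<Longrightarrow> (e = - 1 \<Longrightarrow> P) \<Longrightarrow> P"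
  by (auto simp: abs_if split: if_splits)

lemma liso_comp:
  assumes "liso g x" "liso f (g x)"
  shows "liso (f \<circ> g) x"
proof -
  obtain e r where g: "\<bar>e\<bar> = 1" "r > 0" "\<And>y. \<bar>y - x\<bar> < r \<Longrightarrow> g y = g x + e * (y - x)"
    using liso_centered[OF assms(1)] by blast
  obtain d s where f: "\<bar>d\<bar> = 1" "s > 0" "\<And>y. \<bar>y - g x\<bar> < s \<Longrightarrow> f y = f (g x) + d * (y - g x)"
    using liso_centered[OF assms(2)] by blast
  show ?thesis
  proof (rule liso_intro[of "d * e" "min r s" _ _ "f (g x) - d * e * x"])
    show "\<bar>d * e\<bar> = 1" "min r s > 0" using f(1,2) g(1,2) by (auto simp: abs_mult)
    fix y assume y: "\<bar>y - x\<bar> < min r s"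
    then have gy: "g y = g x + e * (y - x)" using g(3)[of y] by simp
    then have "\<bar>g y - g x\<bar> < s" using y g(1) by (simp add: abs_mult)
    from f(3)[OF this] have "f (g y) = f (g x) + d * (e * (y - x))" using gy by simp
    then show "(f \<circ> g) y = d * e * y + (f (g x) - d * e * x)"
      by (simp add: algebra_simps)
  qed
qed

lemma liso_inv:
  assumes "bij f" "liso f x"
  shows "liso (finv f) (f x)"
proof -
  obtain e r where g: "\<bar>e\<bar> = 1" "r > 0" "\<And>y. \<bar>y - x\<bar> < r \<Longrightarrow> f y = f x + e * (y - x)"
    using liso_centered[OF assms(2)] by blast
  have ee: "e * e = 1" using g(1) by (elim abs_eq_1_cases) auto
  show ?thesis
  proof (rule liso_intro[of e r _ _ "x - e * f x"])
    fix z assume z: "\<bar>z - f x\<bar> < r"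
    have "\<bar>(x + e * (z - f x)) - x\<bar> < r" using z g(1) by (simp add: abs_mult)
    from g(3)[OF this] have "f (x + e * (z - f x)) = f x + (e * e) * (z - f x)"
      by (simp add: algebra_simps)
    then have "f (x + e * (z - f x)) = z" using ee by simp
    then have "finv f z = x + e * (z - f x)"
      using assms(1) by (metis bij_def inv_f_f)
    then show "finv f z = e * z + (x - e * f x)" by (simp add: algebra_simps)
  qed (use g(1,2) in auto)
qed

lemma open_real_ball:
  fixes x :: real
  assumes "open W" "x \<in> W"
  obtains r where "r > 0" "\<And>y. \<bar>y - x\<bar> < r \<Longrightarrow> y \<in> W"
  using assms unfolding open_dist dist_real_def by blast

lemma liso_open_map:
  assumes "liso f x" "open W" "x \<in> W"
  obtains r where "r > 0" "{f x - r<..<f x + r} \<subseteq> f ` W"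
proof -
  obtain e r where g: "\<bar>e\<bar> = 1" "r > 0" "\<And>y. \<bar>y - x\<bar> < r \<Longrightarrow> f y = f x + e * (y - x)"
    using liso_centered[OF assms(1)] by blast
  obtain s where s: "s > 0" "\<And>y. \<bar>y - x\<bar> < s \<Longrightarrow> y \<in> W"
    using open_real_ball[OF assms(2,3)] by blast
  have ee: "e * e = 1" using g(1) by (elim abs_eq_1_cases) auto
  show thesis
  proof
    show "min r s > 0" using g(2) s(1) by simp
    show "{f x - min r s<..<f x + min r s} \<subseteq> f ` W"
    proof
      fix z assume "z \<in> {f x - min r s<..<f x + min r s}"
      then have z: "\<bar>z - f x\<bar> < min r s" by auto
      have y: "\<bar>(x + e * (z - f x)) - x\<bar> < min r s" using z g(1) by (simp add: abs_mult)
      then have "f (x + e * (z - f x)) = f x + (e * e) * (z - f x)"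
        using g(3)[of "x + e * (z - f x)"] by (simp add: algebra_simps)
      then have "z = f (x + e * (z - f x))" using ee by simp
      moreover have "x + e * (z - f x) \<in> W" using s(2) y by simp
      ultimately show "z \<in> f ` W" by blast
    qed
  qed
qed

lemma breaks_comp: "breaks (f \<circ> g) \<subseteq> breaks g \<union> g -` breaks f"
  using liso_comp unfolding breaks_def by blast

lemma breaks_inv: "bij f \<Longrightarrow> breaks (finv f) \<subseteq> f ` breaks f"
proof
  fix z assume f: "bij f" and z: "z \<in> breaks (finv f)"
  obtain x where "z = f x" using f by (metis bij_pointE)
  then show "z \<in> f ` breaks f" using liso_inv[OF f] z unfolding breaks_def by blast
qed

lemma card_vimage_bij: "bij f \<Longrightarrow> card (f -` A) = card A"
  by (metis bij_def card_image inj_on_subset subset_UNIV surj_image_vimage_eq)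

lemma finite_vimage_bij: "bij f \<Longrightarrow> finite A \<Longrightarrow> finite (f -` A)"
  by (simp add: bij_is_inj finite_vimageI)

lemma open_locally: "open {x. \<exists>r>0. \<forall>y. \<bar>y - x\<bar> < r \<longrightarrow> P y}" for P :: "real \<Rightarrow> bool"
  unfolding open_dist
proof (intro ballI)
  fix x assume "x \<in> {x. \<exists>r>0. \<forall>y. \<bar>y - x\<bar> < r \<longrightarrow> P y}"
  then obtain r where r: "r > 0" "\<And>y. \<bar>y - x\<bar> < r \<Longrightarrow> P y" by blast
  show "\<exists>e>0. \<forall>z. dist z x < e \<longrightarrow> z \<in> {x. \<exists>r>0. \<forall>y. \<bar>y - x\<bar> < r \<longrightarrow> P y}"
  proof (intro exI[of _ "r/2"] conjI allI impI)
    fix z assume "dist z x < r / 2"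
    then have "P y" if "\<bar>y - z\<bar> < r / 2" for y
      using that \<open>dist z x < r / 2\<close> by (intro r(2)) (simp add: dist_real_def abs_if split: if_splits)
    then show "z \<in> {x. \<exists>r>0. \<forall>y. \<bar>y - x\<bar> < r \<longrightarrow> P y}"
      using r(1) by (auto intro!: exI[of _ "r/2"])
  qed (use r in auto)
qed

lemma affine_unique:
  assumes "u < (v::real)" "\<And>y. u < y \<Longrightarrow> y < v \<Longrightarrow> e * y + t = e' * y + t'"
  shows "e = e' \<and> t = (t'::real)"
proof -
  define p where "p = (2 * u + v) / 3"
  define q where "q = (u + 2 * v) / 3"
  have pq: "p < q" "u < p" "p < v" "u < q" "q < v" using assms(1) by (auto simp: p_def q_def)
  have 1: "e * p + t = e' * p + t'" and 2: "e * q + t = e' * q + t'" using assms(2) pq by auto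
  have "(e - e') * (q - p) = 0" using 1 2 by (simp add: algebra_simps)
  then show ?thesis using pq 1 by auto
qed

text \<open>On a connected set without breaks the local isometries agree: the points with a given slope and
intercept form an open set, and the points with any other slope or intercept form an open set as well.\<close>

lemma no_breaks_affine:
  assumes S: "connected S" "S \<inter> breaks f = {}"
  obtains e t where "\<bar>e\<bar> = 1" "\<And>x. x \<in> S \<Longrightarrow> f x = e * x + t"
proof (cases "S = {}")
  case True then show thesis using that[of 1 0] by auto
next
  case False
  then obtain x0 where x0: "x0 \<in> S" by blast
  have li: "liso f x" if "x \<in> S" for x using S(2) that by (auto simp: breaks_def)
  obtain e t r where e: "\<bar>e\<bar> = 1" "r > 0" "\<And>y. \<bar>y - x0\<bar> < r \<Longrightarrow> f y = e * y + t"
    using li[OF x0] unfolding liso_def by blast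
  define N where "N = (\<lambda>P::real \<Rightarrow> bool. {x. \<exists>r>0. \<forall>y. \<bar>y - x\<bar> < r \<longrightarrow> P y})"
  define A where "A = N (\<lambda>y. f y = e * y + t)"
  define B where "B = (\<Union>(e',t')\<in>- {(e,t)}. N (\<lambda>y. f y = e' * y + t'))"
  have op: "open A" "open B" unfolding A_def B_def N_def
    by (auto intro!: open_UN open_locally)
  have "x \<in> A \<union> B" if x: "x \<in> S" for x
  proof -
    obtain e' t' r where "\<bar>e'\<bar> = 1" "r > 0" "\<And>y. \<bar>y - x\<bar> < r \<Longrightarrow> f y = e' * y + t'"
      using li[OF x] unfolding liso_def by blast
    then have "x \<in> N (\<lambda>y. f y = e' * y + t')" by (auto simp: N_def)
    then show ?thesis unfolding A_def B_def by (cases "(e',t') = (e,t)") auto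
  qed
  moreover have "A \<inter> B = {}"
  proof -
    have False if "x \<in> A" "x \<in> B" for x
    proof -
      obtain e' t' where n: "(e',t') \<noteq> (e,t)" "x \<in> N (\<lambda>y. f y = e' * y + t')"
        using \<open>x \<in> B\<close> unfolding B_def by auto
      obtain r where r: "r > 0" "\<And>y. \<bar>y - x\<bar> < r \<Longrightarrow> f y = e' * y + t'"
        using n(2) unfolding N_def by blast
      obtain s where s: "s > 0" "\<And>y. \<bar>y - x\<bar> < s \<Longrightarrow> f y = e * y + t"
        using \<open>x \<in> A\<close> unfolding A_def N_def by blast
      have "e = e' \<and> t = t'"
      proof (rule affine_unique)
        show "x - min r s < x + min r s" using r(1) s(1) by (auto simp: min_def)
        fix y assume "x - min r s < y" "y < x + min r s"
        then have "\<bar>y - x\<bar> < r" "\<bar>y - x\<bar> < s" by (auto simp: abs_if min_def split: if_splits)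
        then show "e * y + t = e' * y + t'" using r(2)[of y] s(2)[of y] by simp
      qed
      then show False using n by auto
    qed
    then show ?thesis by blast
  qed
  moreover have "x0 \<in> A" using e by (auto simp: A_def N_def)
  ultimately have "B \<inter> S = {}" using connectedD[OF S(1) op] x0 by blast
  then have "x \<in> A" if "x \<in> S" for x using that \<open>\<And>x. x \<in> S \<Longrightarrow> x \<in> A \<union> B\<close> by blast
  then have "f x = e * x + t" if "x \<in> S" for x
    using that unfolding A_def N_def by force
  then show thesis using that e(1) by blast
qed

lemma no_breaks_interval:
  assumes "a < b" "{a<..<b} \<inter> breaks f = {}"
  obtains d where "(\<forall>x\<in>{a<..<b}. f x = x - a + d) \<or> (\<forall>x\<in>{a<..<b}. f x = d + b - x)"
    "f ` {a<..<b} = {d<..<d + (b - a)}"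
proof -
  obtain e t where e: "\<bar>e\<bar> = 1" "\<And>x. x \<in> {a<..<b} \<Longrightarrow> f x = e * x + t"
    using no_breaks_affine[OF connected_Ioo assms(2)] by blast
  show thesis
    using e(1)
  proof (rule abs_eq_1_cases)
    assume 1: "e = 1"
    have "f ` {a<..<b} = (\<lambda>x. x + t) ` {a<..<b}" using e(2) 1 by (intro image_cong) auto
    also have "\<dots> = {a + t<..<a + t + (b - a)}" 
      by (auto intro!: image_eqI[of _ _ "_ - t"])
    finally show thesis using that[of "a + t"] e(2) 1 by auto
  next
    assume 1: "e = -1"
    have "f ` {a<..<b} = (\<lambda>x. t - x) ` {a<..<b}" using e(2) 1 by (intro image_cong) auto
    also have "\<dots> = {t - b<..<t - b + (b - a)}"
      by (auto intro!: image_eqI[of _ _ "t - _"])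
    finally show thesis using that[of "t - b"] e(2) 1 by auto
  qed
qed

text \<open>Piecewise isometric bijections of the line with support in \<open>[0,w)\<close>. These are genuine
bijections, not classes; finite ambiguities enter only when two such maps are compared.\<close>

definition piso :: "real \<Rightarrow> (real \<Rightarrow> real) \<Rightarrow> bool" where
  "piso w f \<longleftrightarrow> bij f \<and> finite (breaks f) \<and> (\<forall>x. x \<notin> {0..<w} \<longrightarrow> f x = x)"

text \<open>Involutions in this sense include the identity.\<close>

definition pinvol :: "real \<Rightarrow> (real \<Rightarrow> real) \<Rightarrow> bool" where
  "pinvol w f \<longleftrightarrow> piso w f \<and> (\<forall>x. f (f x) = x)"

lemma breaks_id: "breaks id = {}"
proof -
  have "liso id x" for x by (rule liso_intro[of 1 1 _ _ 0]) auto
  then show ?thesis by (auto simp: breaks_def)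
qed

lemma piso_id [simp]: "piso w id"
  by (simp add: piso_def breaks_id)

lemma piso_comp [intro]:
  assumes "piso w f" "piso w g" shows "piso w (f \<circ> g)"
proof -
  have "finite (breaks g \<union> g -` breaks f)" 
    using assms by (auto simp: piso_def intro!: finite_vimage_bij)
  then have "finite (breaks (f \<circ> g))" using breaks_comp finite_subset by blast
  moreover have "bij (f \<circ> g)" using assms by (auto simp: piso_def intro: bij_comp)
  ultimately show ?thesis using assms by (simp add: piso_def)
qed

lemma piso_inv [intro]:
  assumes "piso w f" shows "piso w (finv f)"
proof -
  have "finite (breaks (finv f))" 
    using assms breaks_inv[of f] finite_subset by (auto simp: piso_def)
  moreover have "finv f x = x" if "x \<notin> {0..<w}" for x
    using assms that by (metis piso_def bij_inv_eq_iff)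
  ultimately show ?thesis using assms by (auto simp: piso_def bij_imp_bij_inv)
qed

lemma piso_bij: "piso w f \<Longrightarrow> bij f"
  and piso_fin: "piso w f \<Longrightarrow> finite (breaks f)"
  and piso_outside: "piso w f \<Longrightarrow> x \<notin> {0..<w} \<Longrightarrow> f x = x"
  by (auto simp: piso_def)

lemma piso_maps: "piso w f \<Longrightarrow> x \<in> {0..<w} \<Longrightarrow> f x \<in> {0..<w}"
  by (metis piso_bij piso_outside bij_pointE)

lemma bij_if_self_inverse: "(\<And>x. f (f x) = x) \<Longrightarrow> bij f"
  by (metis bijI')

lemma pinvol_piso: "pinvol w f \<Longrightarrow> piso w f" by (simp add: pinvol_def)

lemma pinvol_comp_self: "pinvol w f \<Longrightarrow> f \<circ> f = id" by (auto simp: pinvol_def)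

text \<open>The composition of a list of maps, the last one being applied first.\<close>

definition comps :: "(real \<Rightarrow> real) list \<Rightarrow> real \<Rightarrow> real" where
  "comps fs = foldr (\<circ>) fs id"

lemma comps_simps [simp]: "comps [] = id" "comps (f # fs) = f \<circ> comps fs" "comps (fs @ gs) = comps fs \<circ> comps gs"
proof -
  show 1: "comps [] = id" and 2: "comps (f # fs) = f \<circ> comps fs" for f fs by (auto simp: comps_def)
  show "comps (fs @ gs) = comps fs \<circ> comps gs"
    by (induction fs) (auto simp: 1 2 comp_assoc comps_def)
qed

lemma piso_comps: "(\<And>f. f \<in> set fs \<Longrightarrow> piso w f) \<Longrightarrow> piso w (comps fs)"
  by (induction fs) auto

section \<open>Simultaneous flips\<close>

text \<open>Reverse each of the open intervals \<open>(l,r)\<close>, for \<open>(l,r) \<in> J\<close>, and fix all other points, in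
particular the end points. The definition is sensible only for disjoint intervals, which is what
\<open>disj_ivs\<close> below says; degenerate intervals with \<open>l = r\<close> are harmless.\<close>

definition mflip :: "(real \<times> real) set \<Rightarrow> real \<Rightarrow> real" where
  "mflip J x = (if \<exists>p. p \<in> J \<and> fst p < x \<and> x < snd p
     then let p = (SOME p. p \<in> J \<and> fst p < x \<and> x < snd p) in fst p + snd p - x else x)"

definition disj_ivs :: "(real \<times> real) set \<Rightarrow> bool" where
  "disj_ivs J \<longleftrightarrow> (\<forall>p\<in>J. \<forall>q\<in>J. \<forall>x. fst p < x \<and> x < snd p \<and> fst q < x \<and> x < snd q \<longrightarrow> p = q)"

lemma mflip_in:
  assumes "disj_ivs J" "(l,r) \<in> J" "l < x" "x < r"
  shows "mflip J x = l + r - x"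
proof -
  have ex: "(l,r) \<in> J \<and> fst (l,r) < x \<and> x < snd (l,r)" using assms by simp
  have "(SOME p. p \<in> J \<and> fst p < x \<and> x < snd p) = (l,r)"
  proof (rule some_equality)
    show "(l,r) \<in> J \<and> fst (l,r) < x \<and> x < snd (l,r)" by (rule ex)
    fix p assume "p \<in> J \<and> fst p < x \<and> x < snd p"
    then show "p = (l,r)" using assms(1) ex unfolding disj_ivs_def by blast
  qed
  moreover have "\<exists>p. p \<in> J \<and> fst p < x \<and> x < snd p" using ex by blast
  ultimately show ?thesis by (simp add: mflip_def Let_def)
qed

lemma mflip_out: "(\<And>l r. (l,r) \<in> J \<Longrightarrow> \<not> (l < x \<and> x < r)) \<Longrightarrow> mflip J x = x"
  unfolding mflip_def by auto

lemma mflip_mflip: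
  assumes J: "disj_ivs J" shows "mflip J (mflip J x) = x"
proof (cases "\<exists>(l,r)\<in>J. l < x \<and> x < r")
  case True
  then obtain l r where lr: "(l,r) \<in> J" "l < x" "x < r" by auto
  then have "mflip J x = l + r - x" using J by (simp add: mflip_in)
  moreover have "mflip J (l + r - x) = l + r - (l + r - x)" using lr by (intro mflip_in[OF J]) auto
  ultimately show ?thesis by simp
next
  case False
  then have "mflip J x = x" by (intro mflip_out) auto
  then show ?thesis by simp
qed

lemma mflip_breaks:
  assumes J: "disj_ivs J" "finite J" "\<And>l r. (l,r) \<in> J \<Longrightarrow> l \<le> r"
  shows "breaks (mflip J) \<subseteq> fst ` J \<union> snd ` J"
proof
  fix x assume x: "x \<in> breaks (mflip J)"
  show "x \<in> fst ` J \<union> snd ` J"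
  proof (rule ccontr)
    assume n: "x \<notin> fst ` J \<union> snd ` J"
    have "liso (mflip J) x"
    proof (cases "\<exists>(l,r)\<in>J. l < x \<and> x < r")
      case True
      then obtain l r where lr: "(l,r) \<in> J" "l < x" "x < r" by auto
      show ?thesis
      proof (rule liso_intro[of "-1" "min (x - l) (r - x)" _ _ "l + r"])
        fix y assume "\<bar>y - x\<bar> < min (x - l) (r - x)"
        then have "l < y" "y < r" by (auto simp: abs_if split: if_splits)
        then show "mflip J y = - 1 * y + (l + r)" using mflip_in[OF J(1) lr(1)] by simp
      qed (use lr in auto)
    next
      case False
      have mem: "x \<in> - (\<Union>(l,r)\<in>J. {l..r})"
        using False n by (force simp: image_iff less_le)
      have op: "open (- (\<Union>(l,r)\<in>J. {l..r}))"
        using J(2) by (intro open_Compl closed_UN) auto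
      obtain r where r: "r > 0" "\<And>y. \<bar>y - x\<bar> < r \<Longrightarrow> y \<in> - (\<Union>(l,r)\<in>J. {l..r})"
        using open_real_ball[OF op mem] by blast
      show ?thesis
      proof (rule liso_intro[of 1 r _ _ 0])
        fix y assume "\<bar>y - x\<bar> < r"
        then have "\<not> (l < y \<and> y < r)" if "(l,r) \<in> J" for l r
          using r(2)[of y] that by force
        then show "mflip J y = 1 * y + 0" by (simp add: mflip_out)
      qed (use r in auto)
    qed
    then show False using x by (simp add: breaks_def)
  qed
qed

lemma mflip_pinvol:
  assumes J: "disj_ivs J" "finite J" "\<And>l r. (l,r) \<in> J \<Longrightarrow> 0 \<le> l \<and> l \<le> r \<and> r \<le> w"
  shows "pinvol w (mflip J)"
proof -
  have "finite (fst ` J \<union> snd ` J)" using J(2) by simp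
  moreover have "breaks (mflip J) \<subseteq> fst ` J \<union> snd ` J" using J by (intro mflip_breaks) auto
  ultimately have "finite (breaks (mflip J))" by (rule rev_finite_subset)
  moreover have "mflip J x = x" if "x \<notin> {0..<w}" for x
    using J(3) that by (intro mflip_out) force
  ultimately show ?thesis
    using mflip_mflip[OF J(1)] bij_if_self_inverse[of "mflip J"] by (simp add: pinvol_def piso_def)
qed

abbreviation flip :: "real \<Rightarrow> real \<Rightarrow> real \<Rightarrow> real" where
  "flip c d \<equiv> mflip {(c,d)}"

lemma disj_ivs_single [simp]: "disj_ivs {p}" by (auto simp: disj_ivs_def)

lemma flip_in: "c < x \<Longrightarrow> x < d \<Longrightarrow> flip c d x = c + d - x"
  by (rule mflip_in) auto

lemma flip_out: "x \<le> c \<or> d \<le> x \<Longrightarrow> flip c d x = x"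
  by (rule mflip_out) auto

lemma flip_flip: "flip c d (flip c d x) = x"
  by (rule mflip_mflip) simp

lemma flip_pinvol: "0 \<le> c \<Longrightarrow> c \<le> d \<Longrightarrow> d \<le> w \<Longrightarrow> pinvol w (flip c d)"
  by (rule mflip_pinvol) auto

section \<open>Factorization into flips\<close>

lemma Ioo_minus_Icc_finite:
  fixes d e :: real
  assumes "d < e" "finite ({d<..<e} - {a..b})"
  shows "a \<le> d" "e \<le> b"
proof -
  show "a \<le> d"
  proof (rule ccontr)
    assume "\<not> a \<le> d"
    then have "d < min a e" using assms(1) by simp
    moreover have "{d<..<min a e} \<subseteq> {d<..<e} - {a..b}" by auto
    ultimately show False using assms(2) infinite_Ioo finite_subset by blast
  qed
  show "e \<le> b"
  proof (rule ccontr)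
    assume "\<not> e \<le> b"
    then have "max d b < e" using assms(1) by simp
    moreover have "{max d b<..<e} \<subseteq> {d<..<e} - {a..b}" by auto
    ultimately show False using assms(2) infinite_Ioo finite_subset by blast
  qed
qed

text \<open>If \<open>h\<close> fixes almost all points outside \<open>[a,b]\<close>, then by injectivity almost no point of \<open>[a,b]\<close> can leave
this interval.\<close>

lemma image_outside_finite:
  assumes h: "bij h" "finite {x. x \<notin> {a..b} \<and> h x \<noteq> x}" and S: "S \<subseteq> {a..b}"
  shows "finite (h ` S - {a..b})"
proof (rule finite_subset[OF _ h(2)])
  show "h ` S - {a..b} \<subseteq> {x. x \<notin> {a..b} \<and> h x \<noteq> x}"
  proof
    fix z assume "z \<in> h ` S - {a..b}"
    then obtain y where y: "y \<in> S" "z = h y" "z \<notin> {a..b}" by blast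
    have "h z \<noteq> z" using y S h(1) by (metis bij_pointE subsetD)
    then show "z \<in> {x. x \<notin> {a..b} \<and> h x \<noteq> x}" using y by simp
  qed
qed

text \<open>A regular point cannot be mapped into the closure of an interval that is disjoint from the
image of a neighbourhood of that point, because the image of this neighbourhood is a
neighbourhood of \<open>f x\<close>.\<close>

lemma liso_image_no_end:
  assumes f: "bij f" "liso f x" and x: "u < x" "x < v"
    and d: "d < e" "{d<..<e} \<inter> f ` {u<..<v} = {}"
  shows "f x \<notin> {d..e}"
proof
  assume fx: "f x \<in> {d..e}"
  obtain r where r: "r > 0" "{f x - r<..<f x + r} \<subseteq> f ` {u<..<v}"
    using liso_open_map[OF f(2), of "{u<..<v}"] x by auto
  have "\<exists>z. z \<in> {f x - r<..<f x + r} \<and> z \<in> {d<..<e}"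
  proof (cases "f x < e")
    case True
    then show ?thesis using fx r(1) d(1)
      by (intro exI[of _ "min (f x + r / 2) ((f x + e) / 2)"]) (auto simp: min_def)
  next
    case False
    then show ?thesis using fx r(1) d(1)
      by (intro exI[of _ "max (f x - r / 2) ((f x + d) / 2)"]) (auto simp: max_def)
  qed
  then show False using r(2) d(2) by blast
qed

text \<open>A map of \<open>[a,b]\<close> with \<open>n\<close> breaks in the interior is, up to finitely many points, a product of at
most \<open>2 * n + 1\<close> flips. The leftmost piece \<open>(a,c)\<close> has an interval \<open>(d,e)\<close> as its image. Flipping \<open>(a,e)\<close> after \<open>h\<close>
brings this image back to \<open>(a,c)\<close> and keeps every other image interval in one piece, because none of
them contains \<open>e\<close> in its interior. A flip of \<open>(a,c)\<close> then corrects the orientation if necessary, and the problem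
is reduced to \<open>[c,b]\<close>, where the break \<open>c\<close> no longer counts.\<close>

lemma flip_factor:
  assumes "bij h" "finite (breaks h \<inter> {a<..<b})" "card (breaks h \<inter> {a<..<b}) \<le> n" "a \<le> b"
    and "finite {x. x \<notin> {a..b} \<and> h x \<noteq> x}"
  shows "\<exists>fs. length fs \<le> 2 * n + 1 \<and> (\<forall>f\<in>set fs. \<exists>c d. a \<le> c \<and> c \<le> d \<and> d \<le> b \<and> f = flip c d)
           \<and> finite {x. h x \<noteq> comps fs x}"
  using assms
proof (induction n arbitrary: a h)
  case 0
  show ?case
  proof (cases "a = b")
    case True
    have "{x. h x \<noteq> comps [] x} \<subseteq> {x. x \<notin> {a..b} \<and> h x \<noteq> x} \<union> {a}" using True by auto
    then have "finite {x. h x \<noteq> comps [] x}" using 0(5) finite_subset by blast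
    then show ?thesis by (intro exI[of _ "[]"]) simp
  next
    case False
    then have ab: "a < b" using 0 by simp
    have "{a<..<b} \<inter> breaks h = {}" using 0(2,3) by (auto simp: Int_commute)
    then obtain d where d: "(\<forall>x\<in>{a<..<b}. h x = x - a + d) \<or> (\<forall>x\<in>{a<..<b}. h x = d + b - x)"
      "h ` {a<..<b} = {d<..<d + (b - a)}" using no_breaks_interval[OF ab] by metis
    have "finite (h ` {a<..<b} - {a..b})" using 0 by (intro image_outside_finite) auto
    then have "a \<le> d" "d + (b - a) \<le> b"
      using Ioo_minus_Icc_finite[of d "d + (b - a)" a b] d(2) ab by auto
    then have da: "d = a" by simp
    have fin: "finite ({x. x \<notin> {a..b} \<and> h x \<noteq> x} \<union> {a,b})" using 0(5) by simp
    define c where "c = (if \<forall>x\<in>{a<..<b}. h x = x - a + d then a else b)"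
    have "h x = flip a c x" if x: "x \<in> {a<..<b}" for x
    proof (cases "\<forall>x\<in>{a<..<b}. h x = x - a + d")
      case True then show ?thesis using x da by (simp add: c_def flip_out)
    next
      case False then show ?thesis using x d da by (auto simp: c_def flip_in)
    qed
    moreover have "flip a c x = x" if "x \<notin> {a..b}" for x using that ab
      by (intro flip_out) (auto simp: c_def)
    ultimately have "h x = comps [flip a c] x" if "x \<notin> {x. x \<notin> {a..b} \<and> h x \<noteq> x} \<union> {a,b}" for x
      using that by (cases "x \<in> {a<..<b}") auto
    then have "{x. h x \<noteq> comps [flip a c] x} \<subseteq> {x. x \<notin> {a..b} \<and> h x \<noteq> x} \<union> {a,b}" by blast
    then have "finite {x. h x \<noteq> comps [flip a c] x}" using fin finite_subset by blast
    moreover have "a \<le> c" "c \<le> b" using ab by (auto simp: c_def)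
    ultimately show ?thesis by (intro exI[of _ "[flip a c]"]) auto
  qed
next
  case (Suc n)
  show ?case
  proof (cases "card (breaks h \<inter> {a<..<b}) \<le> n")
    case True
    then obtain fs where "length fs \<le> 2 * n + 1"
      "(\<forall>f\<in>set fs. \<exists>c d. a \<le> c \<and> c \<le> d \<and> d \<le> b \<and> f = flip c d)" "finite {x. h x \<noteq> comps fs x}"
      using Suc.IH[OF Suc.prems(1,2) _ Suc.prems(4,5)] by blast
    then show ?thesis by (intro exI[of _ fs]) auto
  next
    case False
    define B where "B = breaks h \<inter> {a<..<b}"
    have B: "finite B" "B \<noteq> {}" using False Suc.prems(2) by (auto simp: B_def)
    define c where "c = Min B"
    have cB: "c \<in> B" unfolding c_def using B by (rule Min_in)
    have c: "a < c" "c < b" using cB by (auto simp: B_def)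
    have "{a<..<c} \<inter> B = {}" using Min_le[OF B(1)] by (force simp: c_def)
    then have nb: "{a<..<c} \<inter> breaks h = {}" using c by (auto simp: B_def)
    obtain d where d: "(\<forall>x\<in>{a<..<c}. h x = x - a + d) \<or> (\<forall>x\<in>{a<..<c}. h x = d + c - x)"
      "h ` {a<..<c} = {d<..<d + (c - a)}" using no_breaks_interval[OF c(1) nb] by metis
    define e where "e = d + (c - a)"
    have "finite (h ` {a<..<c} - {a..b})" using Suc.prems c by (intro image_outside_finite) auto
    then have de: "a \<le> d" "e \<le> b" "d < e"
      using Ioo_minus_Icc_finite[of d e a b] d(2) c by (auto simp: e_def)
    \<comment> \<open>The flip of \<open>(a,k)\<close> is the orientation correction; it is trivial for \<open>k = a\<close>.\<close>
    define k where "k = (if \<forall>x\<in>{a<..<c}. h x = x - a + d then c else a)"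
    have k: "a \<le> k" "k \<le> c" using c by (auto simp: k_def)
    define h' where "h' = flip a k \<circ> (flip a e \<circ> h)"
    have bf: "bij (flip u v)" for u v by (rule bij_if_self_inverse) (rule flip_flip)
    have bh': "bij h'" unfolding h'_def by (intro bij_comp Suc.prems bf)
    have h'_id: "h' x = x" if x: "x \<in> {a<..<c}" for x
    proof (cases "\<forall>x\<in>{a<..<c}. h x = x - a + d")
      case True
      have hx: "h x = x - a + d" using True x by blast
      have "flip a e (h x) = a + c - x" using x de unfolding hx by (subst flip_in) (auto simp: e_def)
      then show ?thesis using x True by (simp add: h'_def k_def flip_in)
    next
      case False
      then have hx: "h x = d + c - x" using d(1) x by blast
      have "flip a e (h x) = x" using x de unfolding hx by (subst flip_in) (auto simp: e_def)
      then show ?thesis using x False by (auto simp: h'_def k_def flip_out)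
    qed
    have out: "{x. x \<notin> {c..b} \<and> h' x \<noteq> x} \<subseteq> insert a {x. x \<notin> {a..b} \<and> h x \<noteq> x}"
    proof
      fix x assume x: "x \<in> {x. x \<notin> {c..b} \<and> h' x \<noteq> x}"
      then have "x \<notin> {a<..<c}" using h'_id by blast
      then have "x = a \<or> x \<notin> {a..b}" using x by auto
      moreover have "h' x = x" if "x \<notin> {a..b}" "h x = x"
      proof -
        have "flip a e x = x" "flip a k x = x" using that de k c by (auto intro!: flip_out)
        then show ?thesis using that by (simp add: h'_def)
      qed
      ultimately show "x \<in> insert a {x. x \<notin> {a..b} \<and> h x \<noteq> x}" using x by blast
    qed
    have fin': "finite {x. x \<notin> {c..b} \<and> h' x \<noteq> x}"
      by (rule finite_subset[OF out]) (use Suc.prems(5) in simp)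
    have br: "breaks h' \<inter> {c<..<b} \<subseteq> B - {c}"
    proof
      fix x assume x: "x \<in> breaks h' \<inter> {c<..<b}"
      have "\<not> liso h x \<or> x \<notin> {c<..<b}"
      proof (rule ccontr)
        assume "\<not> (\<not> liso h x \<or> x \<notin> {c<..<b})"
        then have li: "liso h x" and xcb: "c < x" "x < b" by auto
        have inj: "inj h" "inj (flip a e \<circ> h)" using Suc.prems(1) bf by (auto simp: bij_is_inj intro!: bij_is_inj bij_comp)
        have "h ` {a<..<c} \<inter> h ` {c<..<b} = {}"
          using inj(1) by (subst image_Int[symmetric]) auto
        then have he: "h x \<notin> {d..e}" using d(2) de xcb
          by (intro liso_image_no_end[OF Suc.prems(1) li xcb]) (auto simp: e_def)
        \<comment> \<open>A neighbourhood of \<open>a\<close> contains infinitely many points outside \<open>[a,b]\<close>.\<close>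
        have ha: "h x \<noteq> a"
        proof
          assume "h x = a"
          obtain r where r: "r > 0" "{h x - r<..<h x + r} \<subseteq> h ` {c<..<b}"
            using liso_open_map[OF li, of "{c<..<b}"] xcb by auto
          have "finite (h ` {c<..<b} - {a..b})" 
            using Suc.prems c by (intro image_outside_finite) auto
          then have "finite ({h x - r<..<h x + r} - {a..b})" 
            by (rule finite_subset[OF Diff_mono[OF r(2) order_refl]])
          from Ioo_minus_Icc_finite(1)[OF _ this] have "a \<le> h x - r" using r(1) by simp
          then show False using \<open>h x = a\<close> r(1) by simp
        qed
        have "breaks (flip a e) \<subseteq> {a, e}" using mflip_breaks[of "{(a,e)}"] de by auto
        then have "liso (flip a e) (h x)" using ha he de by (auto simp: breaks_def)
        then have li2: "liso (flip a e \<circ> h) x" using li liso_comp by blast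
        have sub: "{a<..<c} \<subseteq> (flip a e \<circ> h) ` {a<..<c}"
        proof
          fix y assume y: "y \<in> {a<..<c}"
          have "\<exists>y'\<in>{a<..<c}. flip a e (h y') = y"
          proof (cases "\<forall>x\<in>{a<..<c}. h x = x - a + d")
            case True
            then have "h (a + c - y) = e + a - y" using y by (auto simp: e_def)
            moreover have "flip a e (e + a - y) = y" using y de by (subst flip_in) (auto simp: e_def)
            ultimately show ?thesis using y by (intro bexI[of _ "a + c - y"]) auto
          next
            case False
            then have "h y = d + c - y" using y d(1) by blast
            moreover have "flip a e (d + c - y) = y" using y de by (subst flip_in) (auto simp: e_def)
            ultimately show ?thesis using y by (intro bexI[of _ y]) auto
          qed
          then show "y \<in> (flip a e \<circ> h) ` {a<..<c}" by force
        qed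
        have "(flip a e \<circ> h) ` {a<..<c} \<inter> (flip a e \<circ> h) ` {c<..<b} = {}"
          using inj(2) by (subst image_Int[symmetric]) auto
        then have "(flip a e \<circ> h) x \<notin> {a..c}" using sub c
          by (intro liso_image_no_end[OF _ li2 xcb]) (auto intro!: bij_comp Suc.prems bf simp del: comp_apply)
        moreover have "breaks (flip a k) \<subseteq> {a, k}" using mflip_breaks[of "{(a,k)}"] k by auto
        ultimately have "liso (flip a k) ((flip a e \<circ> h) x)" using k c by (auto simp: breaks_def)
        then have "liso h' x" unfolding h'_def using li2 liso_comp by blast
        then show False using x by (simp add: breaks_def)
      qed
      then show "x \<in> B - {c}" using x c by (auto simp: B_def breaks_def)
    qed
    have "card (B - {c}) \<le> n" using Suc.prems(3) cB B(1) by (simp add: B_def[symmetric])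
    moreover have fB: "finite (B - {c})" using B(1) by simp
    ultimately have "card (breaks h' \<inter> {c<..<b}) \<le> n" "finite (breaks h' \<inter> {c<..<b})"
      using card_mono[OF fB br] finite_subset[OF br fB] by linarith+
    then obtain fs where fs: "length fs \<le> 2 * n + 1"
      "\<And>f. f\<in>set fs \<Longrightarrow> \<exists>u v. c \<le> u \<and> u \<le> v \<and> v \<le> b \<and> f = flip u v" "finite {x. h' x \<noteq> comps fs x}"
      using Suc.IH[OF bh' _ _ _ fin'] c less_imp_le by metis
    define gs where "gs = flip a e # flip a k # fs"
    have "h x = comps gs x" if "h' x = comps fs x" for x
      using that[symmetric] by (simp add: gs_def h'_def flip_flip)
    then have "{x. h x \<noteq> comps gs x} \<subseteq> {x. h' x \<noteq> comps fs x}" by blast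
    then have "finite {x. h x \<noteq> comps gs x}" using fs(3) by (rule finite_subset)
    moreover have "length gs \<le> 2 * Suc n + 1" using fs(1) by (simp add: gs_def)
    moreover have "\<exists>u v. a \<le> u \<and> u \<le> v \<and> v \<le> b \<and> f = flip u v" if f: "f \<in> set gs" for f
    proof -
      consider "f = flip a e" | "f = flip a k" | "f \<in> set fs" using f by (auto simp: gs_def)
      then show ?thesis
      proof cases
        case 3
        then obtain u v where "c \<le> u" "u \<le> v" "v \<le> b" "f = flip u v" using fs(2)[of f] by blast
        then show ?thesis using c by (intro exI[of _ u] exI[of _ v]) auto
      next
        case 1 then show ?thesis using de by (intro exI[of _ a] exI[of _ e]) auto
      next
        case 2 then show ?thesis using k c by (intro exI[of _ a] exI[of _ k]) auto
      qed
    qed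
    ultimately show ?thesis by blast
  qed
qed

section \<open>Block maps\<close>

text \<open>The half line \<open>[0,\<infinity>)\<close> is divided into blocks \<open>[k * w, (k + 1) * w)\<close>. A block map sends block \<open>k\<close> to
block \<open>\<alpha> k\<close> and acts inside as \<open>u k\<close>, transported from \<open>[0,w)\<close>. Block maps multiply like
permutation matrices with entries \<open>u k\<close>.\<close>

definition blk :: "real \<Rightarrow> (nat \<Rightarrow> nat) \<Rightarrow> (nat \<Rightarrow> real \<Rightarrow> real) \<Rightarrow> real \<Rightarrow> real" where
  "blk w \<alpha> u x = (if x < 0 then x
     else let k = nat \<lfloor>x / w\<rfloor> in real (\<alpha> k) * w + u k (x - real k * w))"

lemma blk_apply:
  assumes "0 \<le> y" "y < w"
  shows "blk w \<alpha> u (real k * w + y) = real (\<alpha> k) * w + u k y"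
proof -
  have w: "w > 0" using assms by simp
  then have "(real k * w + y) / w = real k + y / w" by (simp add: field_simps)
  moreover have "0 \<le> y / w" "y / w < 1" using assms w by auto
  ultimately have "\<lfloor>(real k * w + y) / w\<rfloor> = int k" by linarith
  moreover have "0 \<le> real k * w" using w by simp
  then have "\<not> real k * w + y < 0" using assms by linarith
  ultimately show ?thesis by (simp add: blk_def Let_def)
qed

lemma blk_neg: "x < 0 \<Longrightarrow> blk w \<alpha> u x = x"
  by (simp add: blk_def)

lemma block_cases:
  assumes "w > 0"
  obtains "x < 0" | k y where "x = real k * w + y" "0 \<le> y" "y < w"
proof (cases "x < 0")
  case False
  define k where "k = nat \<lfloor>x / w\<rfloor>"
  have "real k = of_int \<lfloor>x / w\<rfloor>" using False assms by (simp add: k_def)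
  then have "real k \<le> x / w" "x / w < real k + 1" by linarith+
  then have "real k * w \<le> x" "x < (real k + 1) * w" using assms by (auto simp: field_simps)
  then show thesis using that(2)[of k "x - real k * w"] by (auto simp: algebra_simps)
qed (use that in auto)

lemma blk_comp:
  assumes w: "w > 0" and v: "\<And>k y. y \<in> {0..<w} \<Longrightarrow> v k y \<in> {0..<w}"
  shows "blk w \<alpha> u \<circ> blk w \<beta> v = blk w (\<alpha> \<circ> \<beta>) (\<lambda>k. u (\<beta> k) \<circ> v k)"
proof
  fix x show "(blk w \<alpha> u \<circ> blk w \<beta> v) x = blk w (\<alpha> \<circ> \<beta>) (\<lambda>k. u (\<beta> k) \<circ> v k) x"
  proof (cases x rule: block_cases[OF w])
    case (2 k y)
    then show ?thesis using v[of y k] by (simp add: blk_apply)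
  qed (auto simp: blk_neg)
qed

lemma blk_eq_id:
  assumes "w > 0" "\<And>k. \<alpha> k = k" "\<And>k y. y \<in> {0..<w} \<Longrightarrow> u k y = y"
  shows "blk w \<alpha> u = id"
proof
  fix x show "blk w \<alpha> u x = id x"
  proof (cases x rule: block_cases[OF assms(1)])
    case (2 k y)
    then show ?thesis using assms by (simp add: blk_apply)
  qed (auto simp: blk_neg)
qed

lemma blk_fix:
  assumes w: "w > 0" and "\<And>k. k \<ge> m \<Longrightarrow> \<alpha> k = k" "\<And>k. k \<ge> m \<Longrightarrow> u k = id"
    and x: "x < 0 \<or> real m * w \<le> x"
  shows "blk w \<alpha> u x = x"
proof (cases x rule: block_cases[OF w])
  case (2 k y)
  have "m \<le> k"
  proof (rule ccontr)
    assume "\<not> m \<le> k"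
    then have "real k + 1 \<le> real m" by simp
    then have "(real k + 1) * w \<le> real m * w" using w by (intro mult_right_mono) auto
    then have "real k * w + w \<le> real m * w" by (simp add: algebra_simps)
    moreover have "0 \<le> real k * w" using w by simp
    ultimately show False using x 2 by linarith
  qed
  then show ?thesis using 2 assms by (simp add: blk_apply)
qed (simp add: blk_neg)

lemma blk_breaks:
  assumes w: "w > 0" and a: "\<And>k. k \<ge> m \<Longrightarrow> \<alpha> k = k" "\<And>k. k \<ge> m \<Longrightarrow> u k = id"
  shows "breaks (blk w \<alpha> u) \<subseteq>
     (\<lambda>k. real k * w) ` {..m} \<union> (\<Union>k<m. (\<lambda>y. real k * w + y) ` breaks (u k))"
    (is "_ \<subseteq> ?R")
proof
  fix x assume x: "x \<in> breaks (blk w \<alpha> u)"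
  show "x \<in> ?R"
  proof (rule ccontr)
    assume nR: "x \<notin> ?R"
    have far: "liso (blk w \<alpha> u) x" if o: "open W" "x \<in> W" and W: "\<And>z. z \<in> W \<Longrightarrow> z < 0 \<or> real m * w \<le> z" for W
    proof -
      obtain r where r: "r > 0" "\<And>y. \<bar>y - x\<bar> < r \<Longrightarrow> y \<in> W" using open_real_ball[OF o] by blast
      show ?thesis
      proof (rule liso_intro[of 1 r _ _ 0])
        fix y assume "\<bar>y - x\<bar> < r"
        then show "blk w \<alpha> u y = 1 * y + 0" using W[OF r(2)] blk_fix[where m = m] w a by simp
      qed (use r(1) in auto)
    qed
    have "liso (blk w \<alpha> u) x"
    proof (cases x rule: block_cases[OF w(1)])
      case 1 then show ?thesis using far[of "{..<0}"] by auto
    next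
      case (2 k y)
      show ?thesis
      proof (cases "k < m")
        case False
        have "x \<noteq> real m * w" using nR by auto
        moreover have "real m * w \<le> real k * w" using False w by (intro mult_right_mono) auto
        ultimately have "real m * w < x" using 2 by linarith
        then show ?thesis using far[of "{real m * w<..}"] by auto
      next
        case True
        then have "y \<noteq> 0" using nR 2 by force
        then have y: "0 < y" using 2 by simp
        have "y \<notin> breaks (u k)" using nR 2 True by blast
        then have "liso (u k) y" by (simp add: breaks_def)
        then obtain e t r where e: "\<bar>e\<bar> = 1" "r > 0" "\<And>z. \<bar>z - y\<bar> < r \<Longrightarrow> u k z = e * z + t"
          unfolding liso_def by blast
        show ?thesis
        proof (rule liso_intro[of e "min r (min y (w - y))" _ _ "real (\<alpha> k) * w - e * (real k * w) + t"])
          fix z assume z: "\<bar>z - x\<bar> < min r (min y (w - y))"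
          define v where "v = z - real k * w"
          have v: "\<bar>v - y\<bar> < r" "0 \<le> v" "v < w" using z 2 by (auto simp: v_def abs_if split: if_splits)
          have "z = real k * w + v" by (simp add: v_def)
          then have "blk w \<alpha> u z = real (\<alpha> k) * w + (e * v + t)"
            using v e(3)[of v] by (simp add: blk_apply)
          then show "blk w \<alpha> u z = e * z + (real (\<alpha> k) * w - e * (real k * w) + t)"
            by (simp add: v_def algebra_simps)
        qed (use e(1,2) y 2 in auto)
      qed
    qed
    then show False using x by (simp add: breaks_def)
  qed
qed

lemma blk_piso:
  assumes w: "w > 0" "real m * w \<le> 1" and a: "\<And>k. k \<ge> m \<Longrightarrow> \<alpha> k = k" "\<And>k. k \<ge> m \<Longrightarrow> u k = id"
    and "\<And>k. finite (breaks (u k))" "bij (blk w \<alpha> u)"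
  shows "piso 1 (blk w \<alpha> u)"
proof -
  have "finite (breaks (blk w \<alpha> u))"
    by (rule finite_subset[OF blk_breaks[of w m \<alpha> u]]) (use assms in auto)
  moreover have "blk w \<alpha> u x = x" if "x \<notin> {0..<1}" for x
    using blk_fix[of w m \<alpha> u x] w a that by auto
  ultimately show ?thesis using assms(6) by (simp add: piso_def)
qed

lemma blk_pinvol:
  assumes w: "w > 0" "real m * w \<le> 1" and a: "\<And>k. k \<ge> m \<Longrightarrow> \<alpha> k = k" "\<And>k. k \<ge> m \<Longrightarrow> u k = id"
    and u: "\<And>k. piso w (u k)" "\<And>k. \<alpha> (\<alpha> k) = k" "\<And>k y. u (\<alpha> k) (u k y) = y"
  shows "pinvol 1 (blk w \<alpha> u)"
proof -
  have "blk w \<alpha> u \<circ> blk w \<alpha> u = blk w (\<alpha> \<circ> \<alpha>) (\<lambda>k. u (\<alpha> k) \<circ> u k)"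
    by (rule blk_comp[OF w(1) piso_maps[OF u(1)]])
  also have "\<dots> = id" using w u by (intro blk_eq_id) auto
  finally have inv: "blk w \<alpha> u (blk w \<alpha> u x) = x" for x by (simp add: fun_eq_iff)
  have "piso 1 (blk w \<alpha> u)"
    using w a piso_fin[OF u(1)] bij_if_self_inverse[OF inv] by (intro blk_piso[where m = m])
  then show ?thesis using inv by (simp add: pinvol_def)
qed

text \<open>A block diagonal map whose entries on paired blocks are mutually inverse is a product
  of two involutions.\<close>

lemma blk_pairs:
  assumes w: "w > 0" "real m * w \<le> 1" and a: "\<And>k. k \<ge> m \<Longrightarrow> \<alpha> k = k" "\<And>k. k \<ge> m \<Longrightarrow> u k = id"
    and u: "\<And>k. piso w (u k)" "\<And>k. \<alpha> (\<alpha> k) = k" "\<And>k y. u (\<alpha> k) (u k y) = y"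
  shows "blk w id u = blk w \<alpha> (\<lambda>_. id) \<circ> blk w \<alpha> u"
    "pinvol 1 (blk w \<alpha> (\<lambda>_. id))" "pinvol 1 (blk w \<alpha> u)"
proof -
  have "blk w \<alpha> (\<lambda>_. id) \<circ> blk w \<alpha> u = blk w (\<alpha> \<circ> \<alpha>) (\<lambda>k. id \<circ> u k)"
    by (rule blk_comp[OF w(1) piso_maps[OF u(1)]])
  moreover have "\<alpha> \<circ> \<alpha> = id" using u(2) by auto
  ultimately show "blk w id u = blk w \<alpha> (\<lambda>_. id) \<circ> blk w \<alpha> u" by simp
  show "pinvol 1 (blk w \<alpha> (\<lambda>_. id))" using w a u by (intro blk_pinvol[where m = m]) auto
  show "pinvol 1 (blk w \<alpha> u)" using assms by (intro blk_pinvol[where m = m])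
qed

section \<open>Compressing a long product\<close>

text \<open>A product of many involutions supported in a sufficiently short interval \<open>[0,w)\<close> is a product of
five. With \<open>W j\<close> the product of the first \<open>N - j\<close> factors, the following identity of block diagonal maps holds:

\<open>diag (W 0, 1, 1, 1, \<dots>) = diag (W 0, (W 0)\<^sup>-\<^sup>1, W 2, (W 2)\<^sup>-\<^sup>1, \<dots>) \<circ> diag (1, W 1, (W 1)\<^sup>-\<^sup>1, W 3, (W 3)\<^sup>-\<^sup>1, \<dots>) \<circ> diag (1, s 1, s 2, \<dots>)\<close>

Here \<open>s k\<close> is the identity or a conjugate of a single factor, hence an involution, so the last map is an involution.
Each of the other two maps has mutually inverse entries on paired blocks.\<close>

lemma compress:
  assumes w: "w > 0" "real (N + 2) * w \<le> 1"
    and fs: "length fs \<le> N" "\<And>f. f \<in> set fs \<Longrightarrow> pinvol w f"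
  shows "\<exists>ss. length ss = 5 \<and> (\<forall>s\<in>set ss. pinvol 1 s) \<and> comps ss = comps fs"
proof -
  define W where "W = (\<lambda>j. comps (take (N - j) fs))"
  have PW: "piso w (W j)" for j
    unfolding W_def using fs(2) by (intro piso_comps) (auto dest: in_set_takeD simp: pinvol_def)
  have PV: "piso w (finv (W j))" for j using PW by (rule piso_inv)
  have W0: "W 0 = comps fs" using fs(1) by (simp add: W_def)
  have Wid: "W j = id" if "j \<ge> N" for j using that by (simp add: W_def)
  have inv1: "finv (W j) (W j y) = y" and inv2: "W j (finv (W j) y) = y" for j y
    using piso_bij[OF PW[of j]] by (simp_all add: bij_is_inj bij_is_surj surj_f_inv_f)
  have step: "\<exists>f. (\<forall>x. f (f x) = x) \<and> W j = W (Suc j) \<circ> f" for j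
  proof (cases "N - Suc j < length fs \<and> j < N")
    case True
    let ?i = "N - Suc j"
    have "N - j = Suc ?i" using True by (simp add: Suc_diff_Suc)
    then have "take (N - j) fs = take ?i fs @ [fs ! ?i]" using True
      by (simp add: take_Suc_conv_app_nth)
    then have "W j = W (Suc j) \<circ> fs ! ?i" by (simp add: W_def)
    moreover have "pinvol w (fs ! ?i)" using fs(2) True by simp
    ultimately show ?thesis by (auto simp: pinvol_def)
  next
    case False
    then have "W j = W (Suc j)" by (auto simp: W_def)
    then show ?thesis by (intro exI[of _ id]) auto
  qed
  \<comment> \<open>The pairing of \<open>2 * i\<close> with \<open>2 * i + 1\<close>, restricted to the first \<open>N + 2\<close> blocks.\<close>
  define \<alpha> where "\<alpha> = (\<lambda>k::nat. if even k then if k \<le> N then k + 1 else k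
                          else if k \<le> N + 1 then k - 1 else k)"
  define u where "u = (\<lambda>k::nat. if even k then W k else finv (W (k - 1)))"
  \<comment> \<open>The pairing of \<open>2 * i + 1\<close> with \<open>2 * i + 2\<close>, likewise.\<close>
  define \<beta> where "\<beta> = (\<lambda>k::nat. if k = 0 then 0 else if odd k then if k \<le> N then k + 1 else k
                          else if k \<le> N + 1 then k - 1 else k)"
  define v where "v = (\<lambda>k::nat. if k = 0 then id else if odd k then W k else finv (W (k - 1)))"
  define s where "s = (\<lambda>k::nat. if k = 0 then id else if odd k then finv (W k) \<circ> W (k - 1)
                          else W (k - 1) \<circ> finv (W k))"
  have Pu: "piso w (u k)" for k using PW PV by (simp add: u_def)
  have Pv: "piso w (v k)" for k using PW PV by (simp add: v_def)
  have Ps: "piso w (s k)" for k using PW PV by (auto simp: s_def)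
  have big: "W k = id" "finv (W (k - 1)) = id" if "k \<ge> N + 2" for k
    using that Wid[of k] Wid[of "k - 1"] by (auto simp: inv_id)
  have 1: "u k = id" "v k = id" "s k = id" "\<alpha> k = k" "\<beta> k = k" if "k \<ge> N + 2" for k
    using big[OF that] Wid[of "k - 1"] that by (auto simp: u_def v_def s_def \<alpha>_def \<beta>_def)
  have A: "\<alpha> (\<alpha> k) = k" "\<beta> (\<beta> k) = k" for k
    by (auto simp: \<alpha>_def \<beta>_def elim!: evenE oddE) arith
  have U: "u (\<alpha> k) (u k y) = y" for k y
    using inv1 inv2 Wid[of k] Wid[of "k - 1"] by (auto simp: \<alpha>_def u_def)
  have V: "v (\<beta> k) (v k y) = y" for k y
    using inv1 inv2 Wid[of k] Wid[of "k - 1"] by (auto simp: \<beta>_def v_def)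
  have S: "s k (s k y) = y" for k y
  proof (cases k)
    case (Suc j)
    obtain f where f: "\<And>x. f (f x) = x" "W j = W (Suc j) \<circ> f" using step[of j] by blast
    show ?thesis using Suc f(1) inv1 inv2 by (auto simp: s_def f(2))
  qed (simp add: s_def)
  have w2: "real (N + 2) * w \<le> 1" using w by simp
  note pu = blk_pairs[of w "N + 2" \<alpha> u, OF w(1) w2 1(4,1) Pu A(1) U]
  note pv = blk_pairs[of w "N + 2" \<beta> v, OF w(1) w2 1(5,2) Pv A(2) V]
  have ps: "pinvol 1 (blk w id s)"
    using w(1) w2 1(3) Ps S by (intro blk_pinvol[where m = "N + 2"]) auto
  have "blk w id v \<circ> blk w id s = blk w id (\<lambda>k. v k \<circ> s k)"
    using blk_comp[OF w(1) piso_maps[OF Ps], where \<alpha> = id and \<beta> = id and u = v] by simp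
  moreover have Pvs: "piso w (v k \<circ> s k)" for k using Pv Ps by (rule piso_comp)
  have "blk w id u \<circ> blk w id (\<lambda>k. v k \<circ> s k) = blk w id (\<lambda>k. u k \<circ> (v k \<circ> s k))"
    by (subst blk_comp[OF w(1) piso_maps]) (simp_all add: Pvs)
  ultimately have "blk w id u \<circ> (blk w id v \<circ> blk w id s) = blk w id (\<lambda>k. u k \<circ> (v k \<circ> s k))"
    by simp
  also have "\<dots> = W 0"
  proof
    fix x show "blk w id (\<lambda>k. u k \<circ> (v k \<circ> s k)) x = W 0 x"
    proof (cases x rule: block_cases[OF w(1)])
      case 1 then show ?thesis using piso_outside[OF PW] by (simp add: blk_neg)
    next
      case (2 k y)
      show ?thesis
      proof (cases "k = 0")
        case True
        then show ?thesis using 2 blk_apply[of y w id _ 0] by (simp add: u_def v_def s_def)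
      next
        case False
        then have "w \<le> real k * w" using w by simp
        then have "\<not> x < w" using 2 by linarith
        then have "x \<notin> {0..<w}" by simp
        then have "W 0 x = x" by (rule piso_outside[OF PW])
        moreover have "u k (v k (s k y)) = y"
          using False inv1 inv2 by (auto simp: u_def v_def s_def)
        ultimately show ?thesis using 2 by (simp add: blk_apply)
      qed
    qed
  qed
  finally have "comps fs = comps [blk w \<alpha> (\<lambda>_. id), blk w \<alpha> u, blk w \<beta> (\<lambda>_. id), blk w \<beta> v, blk w id s]"
    using pu(1) pv(1) W0 by (simp add: comp_assoc)
  then show ?thesis using pu(2,3) pv(2,3) ps
    by (intro exI[of _ "[blk w \<alpha> (\<lambda>_. id), blk w \<alpha> u, blk w \<beta> (\<lambda>_. id), blk w \<beta> v, blk w id s]"]) auto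
qed

section \<open>Permutations of blocks\<close>

text \<open>A bijection acts on each of its orbits as a shift on the integers or on a finite cyclic group,
hence it is the product of two reflections. The reflection \<open>a\<close> maps \<open>p\<^sup>n c\<close> to \<open>p\<^sup>-\<^sup>n c\<close>, where \<open>c\<close> is a base point
chosen in each orbit; negative powers are avoided by moving them to the other side of the
equations.\<close>

lemma bij_two_involutions:
  fixes p :: "'a \<Rightarrow> 'a"
  assumes "bij p"
  obtains a b where "\<And>x. a (a x) = x" "\<And>x. b (b x) = x" "p = a \<circ> b"
    "\<And>x. p x = x \<Longrightarrow> a x = x \<and> b x = x"
proof -
  have inj: "(p ^^ n) x = (p ^^ n) y \<longleftrightarrow> x = y" for n x y
    using inj_fn[OF bij_is_inj[OF assms]] by (metis injD)
  have add: "(p ^^ m) ((p ^^ n) x) = (p ^^ (m + n)) x" for m n x by (simp add: funpow_add)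
  define E where "E = (\<lambda>x y. \<exists>i j. (p ^^ i) x = (p ^^ j) y)"
  have Esym: "E x y \<Longrightarrow> E y x" for x y unfolding E_def by metis
  have Etrans: "E x z" if xy: "E x y" and yz: "E y z" for x y z
  proof -
    obtain i j k l where "(p ^^ i) x = (p ^^ j) y" "(p ^^ k) y = (p ^^ l) z"
      using xy yz unfolding E_def by blast
    then have "(p ^^ (k + i)) x = (p ^^ (j + l)) z"
      by (metis add add.commute)
    then show ?thesis unfolding E_def by blast
  qed
  have Erefl: "E x x" for x unfolding E_def by blast
  define c where "c = (\<lambda>x. SOME y. E x y)"
  have cE: "E x (c x)" for x unfolding c_def using Erefl by (rule someI)
  have c_eq: "c x = c y" if "E x y" for x y
  proof -
    have "E x = E y" using that Esym Etrans by blast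
    then show ?thesis by (simp add: c_def)
  qed
  \<comment> \<open>If \<open>x = p\<^sup>n c\<close> with \<open>n = j - i\<close>, then \<open>T x y\<close> says \<open>y = p\<^sup>-\<^sup>n c\<close>.\<close>
  define T where "T = (\<lambda>x y. \<exists>i j. (p ^^ i) x = (p ^^ j) (c x) \<and> (p ^^ j) y = (p ^^ i) (c x))"
  have Tfun: "y = y'" if T1: "T x y" and T2: "T x y'" for x y y'
  proof -
    obtain i j where 1: "(p ^^ i) x = (p ^^ j) (c x)" "(p ^^ j) y = (p ^^ i) (c x)"
      using T1 unfolding T_def by blast
    obtain k l where 2: "(p ^^ k) x = (p ^^ l) (c x)" "(p ^^ l) y' = (p ^^ k) (c x)"
      using T2 unfolding T_def by blast
    have "(p ^^ (k + j)) (c x) = (p ^^ (i + l)) (c x)"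
      by (metis add add.commute 1(1) 2(1))
    then have "(p ^^ (l + j)) y = (p ^^ (l + j)) y'"
      by (metis add add.commute 1(2) 2(2))
    then show ?thesis using inj by blast
  qed
  have Tex: "\<exists>y. T x y" for x
  proof -
    obtain i j where 1: "(p ^^ i) x = (p ^^ j) (c x)" using cE unfolding E_def by blast
    obtain y where "(p ^^ j) y = (p ^^ i) (c x)"
      using bij_fn[OF assms, of j] by (metis bij_pointE)
    then show ?thesis using 1 unfolding T_def by blast
  qed
  have TE: "E x y" if "T x y" for x y
  proof -
    obtain j i where "(p ^^ j) y = (p ^^ i) (c x)" using \<open>T x y\<close> unfolding T_def by blast
    then have "E y (c x)" unfolding E_def by blast
    then show ?thesis using cE Esym Etrans by blast
  qed
  define a where "a = (\<lambda>x. SOME y. T x y)"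
  have aT: "T x (a x)" for x unfolding a_def by (rule someI_ex[OF Tex])
  have a_eq: "a x = y" if "T x y" for x y using Tfun[OF aT that] .
  have aa: "a (a x) = x" for x
  proof (rule a_eq)
    have "c (a x) = c x" using TE[OF aT] c_eq by metis
    then show "T (a x) x" using aT[of x] unfolding T_def by metis
  qed
  have bb: "a (p (a (p x))) = x" for x
  proof (rule a_eq)
    let ?y = "a (p x)"
    obtain i j where ij: "(p ^^ i) (p x) = (p ^^ j) (c (p x))" "(p ^^ j) ?y = (p ^^ i) (c (p x))"
      using aT[of "p x"] unfolding T_def by blast
    have "E (p x) x" "E ?y (p ?y)"
      unfolding E_def by (intro exI[of _ 0] exI[of _ 1]; simp)+
    then have "E (p ?y) (p x)" using TE[OF aT[of "p x"]] Esym Etrans by blast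
    then have c: "c (p ?y) = c (p x)" by (rule c_eq)
    have "(p ^^ j) (p ?y) = p ((p ^^ j) ?y)" by (simp add: funpow_swap1)
    also have "\<dots> = (p ^^ (Suc i)) (c (p x))" by (simp add: ij(2))
    finally have "(p ^^ j) (p ?y) = (p ^^ (Suc i)) (c (p ?y))" by (simp add: c)
    moreover have "(p ^^ Suc i) x = (p ^^ j) (c (p ?y))"
      using ij(1) c by (simp add: funpow_swap1)
    ultimately show "T (p ?y) x" unfolding T_def by blast
  qed
  have fixed: "a x = x" if "p x = x" for x
  proof (rule a_eq)
    have fx: "(p ^^ n) x = x" for n using that by (induction n) auto
    obtain i j where "(p ^^ i) x = (p ^^ j) (c x)" using cE unfolding E_def by blast
    then have "(p ^^ j) x = (p ^^ j) (c x)" by (simp add: fx)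
    then have "c x = x" using inj by metis
    then show "T x x" unfolding T_def by (intro exI[of _ 0]) auto
  qed
  show thesis
  proof (rule that[of a "a \<circ> p"])
    show "p = a \<circ> (a \<circ> p)" by (auto simp: aa)
  qed (use aa bb fixed in auto)
qed

lemma inj_on_extend_bij:
  assumes S: "finite S" "A \<subseteq> S" and f: "inj_on f A" "f ` A \<subseteq> S"
  obtains p where "bij p" "\<And>x. x \<notin> S \<Longrightarrow> p x = x" "\<And>x. x \<in> A \<Longrightarrow> p x = f x"
proof -
  have "card (S - A) = card (S - f ` A)"
    using S f by (simp add: card_Diff_subset finite_subset card_image)
  then obtain b where b: "bij_betw b (S - A) (S - f ` A)"
    using S(1) finite_same_card_bij by blast
  define p where "p = (\<lambda>x. if x \<in> A then f x else if x \<in> S then b x else x)"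
  have 1: "bij_betw p A (f ` A)" 
    using f(1) inj_on_imp_bij_betw by (subst bij_betw_cong[of _ _ f]) (auto simp: p_def)
  have 2: "bij_betw p (S - A) (S - f ` A)"
    using b by (subst bij_betw_cong[of _ _ b]) (auto simp: p_def)
  have 3: "bij_betw p (- S) (- S)"
    using S(2) by (subst bij_betw_cong[of _ _ id]) (auto simp: p_def)
  have "bij_betw p (A \<union> (S - A)) (f ` A \<union> (S - f ` A))"
    by (rule bij_betw_combine[OF 1 2]) auto
  then have "bij_betw p (A \<union> (S - A) \<union> - S) (f ` A \<union> (S - f ` A) \<union> - S)"
    by (rule bij_betw_combine[OF _ 3]) (use f in auto)
  moreover have "A \<union> (S - A) \<union> - S = UNIV" "f ` A \<union> (S - f ` A) \<union> - S = UNIV" using S f by auto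
  ultimately have "bij p" by simp
  then show thesis by (rule that) (use S in \<open>auto simp: p_def\<close>)
qed

abbreviation bperm :: "real \<Rightarrow> (nat \<Rightarrow> nat) \<Rightarrow> real \<Rightarrow> real" where
  "bperm w \<alpha> \<equiv> blk w \<alpha> (\<lambda>_. id)"

lemma bperm_comp: "w > 0 \<Longrightarrow> bperm w \<alpha> \<circ> bperm w \<beta> = bperm w (\<alpha> \<circ> \<beta>)"
  by (subst blk_comp) auto

lemma bperm_two_involutions:
  assumes w: "w > 0" "real m * w \<le> 1" and p: "bij p" "\<And>k. k \<ge> m \<Longrightarrow> p k = k"
  obtains s t where "pinvol 1 s" "pinvol 1 t" "bperm w p = s \<circ> t"
proof -
  obtain a b where ab: "\<And>x. a (a x) = x" "\<And>x. b (b x) = x" "p = a \<circ> b"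
    "\<And>x. p x = x \<Longrightarrow> a x = x \<and> b x = x" using bij_two_involutions[OF p(1)] by metis
  have "pinvol 1 (bperm w a)" "pinvol 1 (bperm w b)"
    using w ab(1,2) ab(4)[OF p(2)] by (auto intro!: blk_pinvol[where m = m])
  moreover have "bperm w p = bperm w a \<circ> bperm w b" using w(1) ab(3) by (simp add: bperm_comp)
  ultimately show thesis using that by blast
qed

section \<open>Aligning with a grid\<close>

lemma card_breaks_comp:
  assumes "piso w f" "piso w g"
  shows "card (breaks (f \<circ> g)) \<le> card (breaks f) + card (breaks g)"
proof -
  have f: "finite (g -` breaks f)" 
    using assms by (auto intro!: finite_vimage_bij simp: piso_def)
  have "card (breaks (f \<circ> g)) \<le> card (breaks g \<union> g -` breaks f)"
    using f assms by (intro card_mono breaks_comp) (auto simp: piso_def)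
  also have "\<dots> \<le> card (breaks g) + card (g -` breaks f)" by (rule card_Un_le)
  finally show ?thesis using card_vimage_bij[OF piso_bij[OF assms(2)]] by simp
qed

lemma card_breaks_mflip:
  assumes "disj_ivs J" "finite J" "\<And>l r. (l,r) \<in> J \<Longrightarrow> l \<le> r"
  shows "card (breaks (mflip J)) \<le> 2 * card J"
proof -
  have "card (breaks (mflip J)) \<le> card (fst ` J \<union> snd ` J)"
    using assms by (intro card_mono mflip_breaks) auto
  also have "\<dots> \<le> card (fst ` J) + card (snd ` J)" by (rule card_Un_le)
  also have "\<dots> \<le> card J + card J" using assms(2) by (intro add_mono card_image_le)
  finally show ?thesis by simp
qed

text \<open>The map \<open>f\<close> translates the open blocks of width \<open>1 / q\<close> with index in \<open>K\<close> onto other such blocks.\<close>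

definition aligned :: "nat \<Rightarrow> (real \<Rightarrow> real) \<Rightarrow> nat set \<Rightarrow> (nat \<Rightarrow> nat) \<Rightarrow> bool" where
  "aligned q f K \<pi> \<longleftrightarrow> K \<subseteq> {..<q} \<and> \<pi> ` K \<subseteq> {..<q} \<and> inj_on \<pi> K \<and>
     (\<forall>k\<in>K. \<forall>y. 0 < y \<longrightarrow> y < 1 / real q \<longrightarrow>
        f (real k * (1 / real q) + y) = real (\<pi> k) * (1 / real q) + y)"

text \<open>After multiplication by two involutions, \<open>g\<close> translates all but \<open>c\<close> of the blocks of width \<open>1 / q\<close> onto
blocks. The number \<open>c\<close> and the number of breaks do not depend on \<open>q\<close>. The first involution makes \<open>g\<close>
orientation reversing on every piece \<open>(l, nx l)\<close>. The second one flips an initial part \<open>(l, p l)\<close> of every piece that is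
not too short, which turns \<open>g\<close> into a translation there; \<open>p l\<close> is chosen at distance less than \<open>1 / q\<close> from \<open>nx l\<close> such that
the translation length is a multiple of \<open>1 / q\<close>.\<close>

lemma align_to_grid:
  assumes g: "piso 1 g"
  obtains c c' where "c > 0" "\<And>q. q > 0 \<Longrightarrow> \<exists>R1 R2 K \<pi>. pinvol 1 R1 \<and> pinvol 1 R2
      \<and> card (breaks (g \<circ> R1 \<circ> R2)) \<le> c' \<and> aligned q (g \<circ> R1 \<circ> R2) K \<pi> \<and> q \<le> card K + c"
proof -
  define F where "F = {0,1} \<union> (breaks g \<inter> {0..1})"
  have F: "finite F" "0 \<in> F" "1 \<in> F" "F \<subseteq> {0..1}" using piso_fin[OF g] by (auto simp: F_def)
  define L where "L = {l \<in> F. l < 1}"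
  have L: "finite L" "L \<subseteq> F" using F by (auto simp: L_def)
  have cardL: "card L \<le> card F" using F L by (intro card_mono)
  define nx where "nx = (\<lambda>l. Min {r \<in> F. l < r})"
  have nxm: "nx l \<in> {r \<in> F. l < r}" if "l \<in> L" for l
    unfolding nx_def using F that by (intro Min_in) (auto simp: L_def)
  have nx_le: "nx l \<le> r" if "r \<in> F" "l < r" for l r
    unfolding nx_def using F that by (intro Min_le) auto
  have nx: "l < nx l" "nx l \<le> 1" "0 \<le> l" "nx l \<in> F" "l \<le> nx l" if "l \<in> L" for l
    using nxm[OF that] F(4) L(2) that by auto
  have "\<exists>e t. \<bar>e\<bar> = 1 \<and> (\<forall>x\<in>{l<..<nx l}. g x = e * x + t)" if l: "l \<in> L" for l
  proof -
    have "{l<..<nx l} \<inter> breaks g = {}"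
    proof -
      have False if "x \<in> breaks g" "l < x" "x < nx l" for x
      proof -
        have "x \<in> F" using that nx[OF l] by (auto simp: F_def)
        then show False using nx_le that by force
      qed
      then show ?thesis by auto
    qed
    then show ?thesis using no_breaks_affine[OF connected_Ioo] by metis
  qed
  then obtain e t where et: "\<And>l. l \<in> L \<Longrightarrow> \<bar>e l\<bar> = 1"
      "\<And>l x. l \<in> L \<Longrightarrow> l < x \<Longrightarrow> x < nx l \<Longrightarrow> g x = e l * x + t l"
    by (metis greaterThanLessThan_iff)
  have same: "l = l'" if "l \<in> L" "l' \<in> L" "l < x" "x < nx l" "l' < x" "x < nx l'" for l l' x
    using that nx_le[of l' l] nx_le[of l l'] L(2) by (cases l l' rule: linorder_cases) force+
  have disj: "disj_ivs ((\<lambda>l. (l, r l)) ` M)" if "M \<subseteq> L" "\<And>l. l \<in> M \<Longrightarrow> r l \<le> nx l" for r M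
    unfolding disj_ivs_def
  proof (intro ballI allI impI)
    fix p p' x assume "p \<in> (\<lambda>l. (l, r l)) ` M" "p' \<in> (\<lambda>l. (l, r l)) ` M"
      and x: "fst p < x \<and> x < snd p \<and> fst p' < x \<and> x < snd p'"
    then obtain l l' where l: "l \<in> M" "l' \<in> M" "p = (l, r l)" "p' = (l', r l')" by blast
    have "l = l'"
      using l x that(1) that(2)[OF l(1)] that(2)[OF l(2)] by (intro same[of l l' x]) auto
    then show "p = p'" using l by simp
  qed
  define J1 where "J1 = (\<lambda>l. (l, nx l)) ` {l \<in> L. e l = 1}"
  define R1 where "R1 = mflip J1"
  have J1: "disj_ivs J1" unfolding J1_def by (rule disj) auto
  have fJ1: "finite J1" "card J1 \<le> card F" using L(1) cardL
    by (auto simp: J1_def intro!: order_trans[OF card_image_le] order_trans[OF card_mono[of L]])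
  have R1: "pinvol 1 R1" unfolding R1_def
    by (rule mflip_pinvol[OF J1 fJ1(1)]) (auto simp: J1_def nx)
  have bR1: "card (breaks R1) \<le> 2 * card J1" unfolding R1_def
    by (rule card_breaks_mflip[OF J1 fJ1(1)]) (auto simp: J1_def nx)
  define T where "T = (\<lambda>l. if e l = 1 then t l + l + nx l else t l)"
  have G1: "g (R1 x) = T l - x" if l: "l \<in> L" and x: "l < x" "x < nx l" for l x
  proof (cases "e l = 1")
    case True
    then have "(l, nx l) \<in> J1" using l by (auto simp: J1_def)
    then have "R1 x = l + nx l - x" unfolding R1_def using x by (intro mflip_in[OF J1])
    then show ?thesis using et(2)[OF l, of "l + nx l - x"] x True by (simp add: T_def)
  next
    case False
    have "R1 x = x" unfolding R1_def
    proof (rule mflip_out)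
      fix l' r assume "(l', r) \<in> J1"
      then have l': "l' \<in> L" "r = nx l'" "e l' = 1" by (auto simp: J1_def)
      then show "\<not> (l' < x \<and> x < r)" using same[OF l l'(1) x] False by auto
    qed
    moreover have "e l = -1" using et(1)[OF l] False by (auto simp: abs_if split: if_splits)
    ultimately show ?thesis using et(2)[OF l x] by (simp add: T_def)
  qed
  show thesis
  proof (rule that[of "2 * card F" "card (breaks g) + 2 * card F + 2 * card F"])
    show "2 * card F > 0" using F by (auto simp: card_gt_0_iff)
    fix q :: nat assume q: "q > 0"
    define w where "w = 1 / real q"
    have w: "w > 0" "real q * w = 1" using q by (auto simp: w_def)
    define j where "j = (\<lambda>l. \<lceil>(T l - l - nx l) * real q\<rceil>)"
    define p where "p = (\<lambda>l. T l - l - of_int (j l) * w)"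
    have p: "p l \<le> nx l" "nx l - w < p l" for l
    proof -
      have "(T l - l - nx l) * real q \<le> of_int (j l)" "of_int (j l) < (T l - l - nx l) * real q + 1"
        unfolding j_def by linarith+
      then have "(T l - l - nx l) * real q * w \<le> of_int (j l) * w"
        "of_int (j l) * w < ((T l - l - nx l) * real q + 1) * w" using w by auto
      moreover have "(T l - l - nx l) * real q * w = T l - l - nx l" using w by simp
      ultimately show "p l \<le> nx l" "nx l - w < p l" by (auto simp: p_def distrib_right)
    qed
    define J2 where "J2 = (\<lambda>l. (l, max l (p l))) ` L"
    define R2 where "R2 = mflip J2"
    have le: "max l (p l) \<le> nx l" if "l \<in> L" for l using p nx(1)[OF that] by simp
    have le1: "max l (p l) \<le> 1" if "l \<in> L" for l by (rule order_trans[OF le nx(2)]; fact)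
    have J2: "disj_ivs J2" unfolding J2_def by (rule disj) (use le in auto)
    have fJ2: "finite J2" "card J2 \<le> card F" using L(1) cardL
      by (auto simp: J2_def intro!: order_trans[OF card_image_le])
    have R2: "pinvol 1 R2" unfolding R2_def
      by (rule mflip_pinvol[OF J2 fJ2(1)]) (use le1 nx(3) in \<open>auto simp: J2_def\<close>)
    have bR2: "card (breaks R2) \<le> 2 * card J2" unfolding R2_def
      by (rule card_breaks_mflip[OF J2 fJ2(1)]) (auto simp: J2_def)
    define G where "G = g \<circ> R1 \<circ> R2"
    have PG: "piso 1 G" "piso 1 (g \<circ> R1)" using g R1 R2 by (auto simp: G_def pinvol_def)
    have G: "G x = x + of_int (j l) * w" if l: "l \<in> L" and x: "l < x" "x < p l" for l x
    proof -
      have m: "max l (p l) = p l" using x by simp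
      have "(l, max l (p l)) \<in> J2" using l by (auto simp: J2_def)
      then have "R2 x = l + p l - x" unfolding R2_def m using x by (intro mflip_in[OF J2])
      moreover have "g (R1 (l + p l - x)) = T l - (l + p l - x)"
        using x p(1)[of l] by (intro G1[OF l]) auto
      ultimately show ?thesis by (simp add: G_def p_def)
    qed
    define K where "K = {k. k < q \<and> (\<exists>l\<in>L. l \<le> real k * w \<and> (real k + 1) * w \<le> p l)}"
    have "\<forall>k\<in>K. \<exists>i::int. \<forall>y. 0 < y \<longrightarrow> y < w \<longrightarrow> G (real k * w + y) = real k * w + y + of_int i * w"
    proof
      fix k assume "k \<in> K"
      then obtain l where l: "l \<in> L" "l \<le> real k * w" "(real k + 1) * w \<le> p l" by (auto simp: K_def)
      have "G (real k * w + y) = real k * w + y + of_int (j l) * w" if "0 < y" "y < w" for y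
        using that l by (intro G[OF l(1)]) (auto simp: distrib_right)
      then show "\<exists>i::int. \<forall>y. 0 < y \<longrightarrow> y < w \<longrightarrow> G (real k * w + y) = real k * w + y + of_int i * w"
        by blast
    qed
    then obtain i where i: "\<And>k y. k \<in> K \<Longrightarrow> 0 < y \<Longrightarrow> y < w \<Longrightarrow>
        G (real k * w + y) = real k * w + y + of_int (i k :: int) * w" by metis
    define \<pi> where "\<pi> = (\<lambda>k. nat (int k + i k))"
    have Kq: "K \<subseteq> {..<q}" by (auto simp: K_def)
    have \<pi>: "int (\<pi> k) = int k + i k" "\<pi> k < q" if k: "k \<in> K" for k
    proof -
      \<comment> \<open>The image of the midpoint of block \<open>k\<close> lies in \<open>[0,1)\<close>, so the index of the image block is in range.\<close>
      let ?x = "real k * w + w / 2"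
      have "real k + 1 \<le> real q" using k by (auto simp: K_def)
      then have "(real k + 1) * w \<le> real q * w" using w by (intro mult_right_mono) auto
      moreover have "0 \<le> real k * w" using w by simp
      ultimately have "?x \<in> {0..<1}" using w by (auto simp: distrib_right)
      then have "G ?x \<in> {0..<1}" by (rule piso_maps[OF PG(1)])
      moreover have "G ?x = (real_of_int (int k + i k) + 1 / 2) * w"
        using i[OF k, of "w / 2"] w by (simp add: algebra_simps)
      ultimately have 1: "0 \<le> (real_of_int (int k + i k) + 1 / 2) * w"
        "(real_of_int (int k + i k) + 1 / 2) * w < real q * w" using w by auto
      then have "0 \<le> real_of_int (int k + i k) + 1 / 2" "real_of_int (int k + i k) + 1 / 2 < real q"
        using w(1) by (auto simp: zero_le_mult_iff mult_less_cancel_right_pos)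
      then have "0 \<le> int k + i k" "int k + i k < int q" by linarith+
      then show "int (\<pi> k) = int k + i k" "\<pi> k < q" by (auto simp: \<pi>_def)
    qed
    have G\<pi>: "G (real k * w + y) = real (\<pi> k) * w + y" if "k \<in> K" "0 < y" "y < w" for k y
    proof -
      have "real (\<pi> k) = real k + of_int (i k)" using \<pi>(1)[OF that(1)] by linarith
      then show ?thesis using i[OF that] by (simp add: distrib_right)
    qed
    have "inj_on \<pi> K"
    proof (rule inj_onI)
      fix k k' assume k: "k \<in> K" "k' \<in> K" "\<pi> k = \<pi> k'"
      then have "G (real k * w + w / 2) = G (real k' * w + w / 2)" using w by (simp add: G\<pi>)
      then have "real k * w + w / 2 = real k' * w + w / 2"
        using piso_bij[OF PG(1)] by (metis bij_pointE)
      then show "k = k'" using w by simp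
    qed
    moreover have "q \<le> card K + 2 * card F"
    proof -
      let ?b = "\<lambda>r. nat \<lfloor>r * real q\<rfloor>"
      \<comment> \<open>A point of \<open>F\<close> lies in every bad block or in the block that follows it.\<close>
      have "{..<q} - K \<subseteq> ?b ` F \<union> (\<lambda>r. ?b r - 1) ` F"
      proof
        fix k assume k: "k \<in> {..<q} - K"
        define l where "l = Max {y \<in> F. y \<le> real k * w}"
        have "real k < real q" using k by simp
        then have k1: "real k * w < 1" using w by (metis mult_strict_right_mono)
        have lm: "l \<in> {y \<in> F. y \<le> real k * w}" unfolding l_def
          using F w by (intro Max_in) auto
        then have l: "l \<in> L" "l \<le> real k * w" using k1 by (auto simp: L_def)
        have kr: "real k * w < nx l"
        proof (rule ccontr)
          assume "\<not> real k * w < nx l"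
          then have "nx l \<in> {y \<in> F. y \<le> real k * w}" using nx(4)[OF l(1)] by auto
          then have "nx l \<le> Max {y \<in> F. y \<le> real k * w}" using F(1) by (intro Max_ge) auto
          then have "nx l \<le> l" by (simp only: l_def[symmetric])
          then show False using nx(1)[OF l(1)] by simp
        qed
        have "\<not> (real k + 1) * w \<le> p l" using k l by (auto simp: K_def)
        then have "nx l < (real k + 2) * w" using p(2)[of l] by (simp add: distrib_right)
        then have "nx l * real q < (real k + 2) * w * real q" "real k * w * real q < nx l * real q"
          using kr q by auto
        then have "nx l * real q < real k + 2" "real k < nx l * real q"
          using w by (simp_all add: mult.assoc mult.commute[of w])
        then have "?b (nx l) = k \<or> ?b (nx l) = k + 1" by linarith
        then show "k \<in> ?b ` F \<union> (\<lambda>r. ?b r - 1) ` F" using nx(4)[OF l(1)] by force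
      qed
      then have "card ({..<q} - K) \<le> card (?b ` F \<union> (\<lambda>r. ?b r - 1) ` F)"
        using F(1) by (intro card_mono) auto
      also have "\<dots> \<le> card (?b ` F) + card ((\<lambda>r. ?b r - 1) ` F)" by (rule card_Un_le)
      also have "\<dots> \<le> card F + card F" using F(1) by (intro add_mono card_image_le)
      finally show ?thesis using Kq by (simp add: card_Diff_subset finite_subset)
    qed
    moreover have "card (breaks G) \<le> card (breaks g) + 2 * card F + 2 * card F"
      using card_breaks_comp[OF PG(2) pinvol_piso[OF R2]] card_breaks_comp[OF g pinvol_piso[OF R1]]
        bR1 bR2 fJ1(2) fJ2(2) by (simp add: G_def)
    moreover have "\<pi> ` K \<subseteq> {..<q}" using \<pi>(2) by auto
    ultimately show "\<exists>R1 R2 K \<pi>. pinvol 1 R1 \<and> pinvol 1 R2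
      \<and> card (breaks (g \<circ> R1 \<circ> R2)) \<le> card (breaks g) + 2 * card F + 2 * card F
      \<and> aligned q (g \<circ> R1 \<circ> R2) K \<pi> \<and> q \<le> card K + 2 * card F"
      using R1 R2 Kq G\<pi> unfolding G_def[symmetric] aligned_def w_def[symmetric]
      by (intro exI[of _ R1] exI[of _ R2] exI[of _ K] exI[of _ \<pi>]) (simp add: G_def)
  qed
qed

section \<open>Eleven involutions suffice\<close>

text \<open>Choose a fine grid. By \<open>align_to_grid\<close>, after two involutions \<open>g\<close> becomes a map \<open>G\<close> that translates
all but \<open>c\<close> of the blocks onto blocks. Permutations of blocks before and after \<open>G\<close>, each the product of two involutions, lead to a
map \<open>H\<close> that is the identity outside the first \<open>c\<close> blocks, up to finitely many points. The number of breaks of \<open>H\<close> among these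
blocks is at most \<open>n\<close>, whatever the grid is. So \<open>H\<close> is a product of at most \<open>2 * n + 1\<close> flips, and for a
fine grid this product can be compressed to five involutions.\<close>

lemma piso_product_of_involutions:
  assumes g: "piso 1 g"
  shows "\<exists>ss. length ss = 11 \<and> (\<forall>s\<in>set ss. pinvol 1 s) \<and> finite {x. g x \<noteq> comps ss x}"
proof -
  obtain c c' where c: "c > 0" and align: "\<And>q. q > 0 \<Longrightarrow> \<exists>R1 R2 K \<pi>. pinvol 1 R1 \<and> pinvol 1 R2
      \<and> card (breaks (g \<circ> R1 \<circ> R2)) \<le> c' \<and> aligned q (g \<circ> R1 \<circ> R2) K \<pi> \<and> q \<le> card K + c"
    using align_to_grid[OF g] by metis
  define n where "n = c + c' + (c + 1)"
  define N where "N = 2 * n + 1"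
  \<comment> \<open>With this choice, \<open>N + 2\<close> copies of the first \<open>c\<close> blocks fill \<open>[0,1)\<close>.\<close>
  define q where "q = c * (N + 2)"
  have q: "q > 0" "c \<le> q" using c by (auto simp: q_def)
  obtain R1 R2 K \<pi> where R: "pinvol 1 R1" "pinvol 1 R2" and c': "card (breaks (g \<circ> R1 \<circ> R2)) \<le> c'"
    and al: "aligned q (g \<circ> R1 \<circ> R2) K \<pi>" and cK: "q \<le> card K + c"
    using align[OF q(1)] by blast
  define G where "G = g \<circ> R1 \<circ> R2"
  define w where "w = 1 / real q"
  define \<delta> where "\<delta> = real c * w"
  have w: "w > 0" "real q * w = 1" using q by (auto simp: w_def)
  have PG: "piso 1 G" using g R by (auto simp: G_def pinvol_def)
  have G: "G (real k * w + y) = real (\<pi> k) * w + y" if "k \<in> K" "0 < y" "y < w" for k y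
    using al that unfolding aligned_def G_def w_def by blast
  have K: "K \<subseteq> {..<q}" and \<pi>: "inj_on \<pi> K" "\<pi> ` K \<subseteq> {..<q}"
    using al by (simp_all add: aligned_def)
  have fK: "finite K" using K finite_subset by blast
  have "card {c..<q} \<le> card K" using cK by simp
  then obtain a0 where a0: "inj_on a0 {c..<q}" "a0 ` {c..<q} \<subseteq> K"
    using inj_on_iff_card_le[OF finite_atLeastLessThan fK] by blast
  have cq: "{c..<q} \<subseteq> {..<q}" by auto
  obtain \<alpha> where \<alpha>: "bij \<alpha>" "\<And>k. k \<notin> {..<q} \<Longrightarrow> \<alpha> k = k" "\<And>k. k \<in> {c..<q} \<Longrightarrow> \<alpha> k = a0 k"
    using inj_on_extend_bij[OF finite_lessThan cq a0(1) subset_trans[OF a0(2) K]] by metis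
  have \<alpha>K: "\<alpha> k \<in> K" if "c \<le> k" "k < q" for k using \<alpha>(3)[of k] a0(2) that by auto
  have "inj_on (\<pi> \<circ> a0) {c..<q}" using a0 \<pi>(1) by (intro comp_inj_on) (auto intro: inj_on_subset)
  moreover have "(\<pi> \<circ> a0) ` {c..<q} \<subseteq> {..<q}" using a0(2) \<pi>(2) by fastforce
  ultimately obtain \<gamma> where \<gamma>: "bij \<gamma>" "\<And>k. k \<notin> {..<q} \<Longrightarrow> \<gamma> k = k"
      "\<And>k. k \<in> {c..<q} \<Longrightarrow> \<gamma> k = \<pi> (a0 k)"
    using inj_on_extend_bij[OF finite_lessThan cq] by (metis comp_apply)
  define \<beta> where "\<beta> = finv \<gamma>"
  have \<beta>1: "bij \<beta>" and \<beta>\<gamma>: "\<beta> (\<gamma> k) = k" for k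
    using \<gamma>(1) by (simp_all add: \<beta>_def bij_imp_bij_inv bij_is_inj)
  have fixq: "\<alpha> k = k" "\<beta> k = k" if "k \<ge> q" for k
    using that \<alpha>(2)[of k] \<gamma>(2)[of k] \<beta>\<gamma>[of k] by auto
  have w1: "real q * w \<le> 1" using w by simp
  obtain s1 t1 where A: "pinvol 1 s1" "pinvol 1 t1" "bperm w \<alpha> = s1 \<circ> t1"
    using bperm_two_involutions[OF w(1) w1 \<alpha>(1) fixq(1)] by metis
  obtain s2 t2 where B: "pinvol 1 s2" "pinvol 1 t2" "bperm w \<beta> = s2 \<circ> t2"
    using bperm_two_involutions[OF w(1) w1 \<beta>1 fixq(2)] by metis
  have PA: "piso 1 (bperm w \<alpha>)" and PB: "piso 1 (bperm w \<beta>)" using A B by (auto simp: pinvol_def)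
  define f where "f = G \<circ> bperm w \<alpha>"
  have Pf: "piso 1 f" using PG PA by (auto simp: f_def)
  have f: "f (real k * w + y) = real (\<gamma> k) * w + y" if "c \<le> k" "k < q" "0 < y" "y < w" for k y
  proof -
    have "f (real k * w + y) = G (real (\<alpha> k) * w + y)" using that by (simp add: f_def blk_apply)
    also have "\<dots> = real (\<pi> (\<alpha> k)) * w + y" using that \<alpha>K by (intro G) auto
    finally show ?thesis using that \<alpha>(3)[of k] \<gamma>(3)[of k] by simp
  qed
  define H where "H = bperm w \<beta> \<circ> f"
  have PH: "piso 1 H" using PB Pf by (auto simp: H_def)
  have H: "H (real k * w + y) = real k * w + y" if "c \<le> k" "k < q" "0 < y" "y < w" for k y
    using f[OF that] \<beta>\<gamma> that by (simp add: H_def blk_apply)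
  have "{x. x \<notin> {0..\<delta>} \<and> H x \<noteq> x} \<subseteq> (\<lambda>k. real k * w) ` {..<q}"
  proof
    fix x assume x: "x \<in> {x. x \<notin> {0..\<delta>} \<and> H x \<noteq> x}"
    then have x01: "x \<in> {0..<1}" using piso_outside[OF PH] by blast
    show "x \<in> (\<lambda>k. real k * w) ` {..<q}"
    proof (cases x rule: block_cases[OF w(1)])
      case (2 k y)
      have "real k * w < real q * w" using x01 2 w by auto
      then have kq: "k < q" using w(1) by (simp add: mult_less_cancel_right_pos)
      have "real c * w < (real k + 1) * w" using x x01 2 by (auto simp: \<delta>_def distrib_right)
      then have "c < k + 1" using w(1) by (simp add: mult_less_cancel_right_pos)
      then have "y = 0" using x 2 H[of k y] kq by (cases "y = 0") auto
      then show ?thesis using kq 2 by auto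
    qed (use x01 in auto)
  qed
  then have fin: "finite {x. x \<notin> {0..\<delta>} \<and> H x \<noteq> x}" using finite_subset by blast
  \<comment> \<open>The breaks of \<open>H\<close> before \<open>\<delta>\<close> are grid points, points moved to breaks of \<open>G\<close>, or points mapped by
\<open>f\<close> to the grid. A point of the last kind can only be mapped to the left end of a block which is not the image of a
translated block, or to \<open>1\<close>.\<close>
  define E where "E = (\<lambda>k. real k * w) ` {..<c} \<union> bperm w \<alpha> -` breaks G \<union> f -` ((\<lambda>j. real j * w) ` ({q} \<union> \<gamma> ` {..<c}))"
  have E: "finite E" using piso_bij[OF PA] piso_bij[OF Pf] piso_fin[OF PG]
    by (auto simp: E_def intro!: finite_vimage_bij)
  have "card E \<le> card ((\<lambda>k. real k * w) ` {..<c}) + card (bperm w \<alpha> -` breaks G)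
      + card (f -` ((\<lambda>j. real j * w) ` ({q} \<union> \<gamma> ` {..<c})))"
    unfolding E_def by (rule order_trans[OF card_Un_le add_right_mono[OF card_Un_le]])
  also have "card (bperm w \<alpha> -` breaks G) \<le> c'"
    using card_vimage_bij[OF piso_bij[OF PA]] c' by (simp add: G_def)
  also have "card (f -` ((\<lambda>j. real j * w) ` ({q} \<union> \<gamma> ` {..<c}))) \<le> c + 1"
  proof -
    have "card ((\<lambda>j. real j * w) ` ({q} \<union> \<gamma> ` {..<c})) \<le> card ({q} \<union> \<gamma> ` {..<c})"
      by (intro card_image_le) auto
    also have "\<dots> \<le> 1 + card (\<gamma> ` {..<c})" using card_Un_le[of "{q}" "\<gamma> ` {..<c}"] by simp
    also have "\<dots> \<le> 1 + c" using card_image_le[of "{..<c}" \<gamma>] by simp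
    finally show ?thesis using card_vimage_bij[OF piso_bij[OF Pf]] by simp
  qed
  also have "card ((\<lambda>k. real k * w) ` {..<c}) \<le> c" using card_image_le[of "{..<c}"] by simp
  finally have cE: "card E \<le> n" by (simp add: n_def)
  have br: "breaks H \<inter> {0<..<\<delta>} \<subseteq> E"
  proof
    fix x assume x: "x \<in> breaks H \<inter> {0<..<\<delta>}"
    show "x \<in> E"
    proof (rule ccontr)
      assume nE: "x \<notin> E"
      have "x \<notin> breaks (bperm w \<alpha>)"
      proof
        assume "x \<in> breaks (bperm w \<alpha>)"
        then obtain k where "x = real k * w"
          using blk_breaks[of w q \<alpha> "\<lambda>_. id"] w fixq by (auto simp: breaks_id)
        moreover then have "k < c" using x w(1) by (simp add: \<delta>_def mult_less_cancel_right_pos)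
        ultimately show False using nE by (auto simp: E_def)
      qed
      moreover have "bperm w \<alpha> x \<notin> breaks G" using nE by (auto simp: E_def)
      ultimately have lf: "liso f x" unfolding f_def by (intro liso_comp) (auto simp: breaks_def)
      have "f x \<in> breaks (bperm w \<beta>)"
      proof (rule ccontr)
        assume "f x \<notin> breaks (bperm w \<beta>)"
        then have "liso H x" unfolding H_def using lf by (intro liso_comp) (auto simp: breaks_def)
        then show False using x by (auto simp: breaks_def)
      qed
      then obtain j where j: "f x = real j * w" "j \<le> q"
        using blk_breaks[of w q \<beta> "\<lambda>_. id"] w fixq by (auto simp: breaks_id)
      have jq: "j \<noteq> q" "j \<notin> \<gamma> ` {..<c}" using nE j(1) by (auto simp: E_def)
      obtain k where k: "j = \<gamma> k" using \<gamma>(1) by (metis bij_pointE)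
      have ck: "c \<le> k" using jq(2) k by (metis imageI lessThan_iff not_less)
      have kq: "k < q" using \<gamma>(2)[of k] k j(2) jq(1) by (cases "k < q") auto
      have "{real j * w<..<real j * w + w} \<inter> f ` {0<..<\<delta>} = {}"
      proof -
        have False if z: "real j * w < f z" "f z < real j * w + w" and z2: "0 < z" "z < \<delta>" for z
        proof -
          have "f (real k * w + (f z - real j * w)) = f z"
            using f[OF ck kq, of "f z - real j * w"] z k by simp
          then have "real k * w + (f z - real j * w) = z" using piso_bij[OF Pf] by (metis bij_pointE)
          moreover have "real c * w \<le> real k * w" using ck w(1) by simp
          ultimately show False using z z2 unfolding \<delta>_def by linarith
        qed
        then show ?thesis by auto
      qed
      then have "f x \<notin> {real j * w..real j * w + w}"
        using x w(1) by (intro liso_image_no_end[OF piso_bij[OF Pf] lf, of 0 \<delta>]) auto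
      then show False using j(1) w(1) by auto
    qed
  qed
  have "\<delta> \<ge> 0" using w(1) by (simp add: \<delta>_def)
  moreover have "card (breaks H \<inter> {0<..<\<delta>}) \<le> n" using card_mono[OF E br] cE by simp
  ultimately obtain fs where fs: "length fs \<le> 2 * n + 1"
      "\<And>f. f\<in>set fs \<Longrightarrow> \<exists>u v. 0 \<le> u \<and> u \<le> v \<and> v \<le> \<delta> \<and> f = flip u v" "finite {x. H x \<noteq> comps fs x}"
    using flip_factor[of H 0 \<delta> n] piso_bij[OF PH] finite_subset[OF br E] fin by auto
  have \<delta>: "\<delta> > 0" "real (N + 2) * \<delta> \<le> 1"
  proof -
    show "\<delta> > 0" using c w by (simp add: \<delta>_def)
    have "real (N + 2) * \<delta> = real q * w" by (simp add: \<delta>_def q_def algebra_simps)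
    then show "real (N + 2) * \<delta> \<le> 1" using w by simp
  qed
  have "pinvol \<delta> h" if "h \<in> set fs" for h using fs(2)[OF that] flip_pinvol by blast
  then obtain zs where zs: "length zs = 5" "\<And>s. s \<in> set zs \<Longrightarrow> pinvol 1 s" "comps zs = comps fs"
    using compress[OF \<delta>, of fs] fs(1) by (auto simp: N_def)
  define M where "M = t1 \<circ> s1 \<circ> R2 \<circ> R1"
  have bM: "bij M" unfolding M_def using A R by (auto simp: pinvol_def piso_def intro!: bij_comp)
  define ss where "ss = [t2, s2] @ zs @ [t1, s1, R2, R1]"
  have gx: "g x = t2 (s2 (H (M x)))" for x
    using A B R by (simp add: H_def f_def G_def M_def pinvol_def)
  have "comps ss x = t2 (s2 (comps fs (M x)))" for x using zs(3) by (simp add: ss_def M_def)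
  then have "{x. g x \<noteq> comps ss x} \<subseteq> M -` {x. H x \<noteq> comps fs x}" using gx by auto
  then have "finite {x. g x \<noteq> comps ss x}" 
    using finite_vimage_bij[OF bM fs(3)] finite_subset by blast
  moreover have "\<forall>s\<in>set ss. pinvol 1 s" using A B R zs(2) by (auto simp: ss_def)
  moreover have "length ss = 11" using zs(1) by (simp add: ss_def)
  ultimately show ?thesis by blast
qed

section \<open>Passage to the group of classes\<close>

text \<open>The FIET on \<open>[0,1)\<close> given by a map of the line, in the extensional representation.\<close>

abbreviation res01 :: "(real \<Rightarrow> real) \<Rightarrow> real \<Rightarrow> real" where
  "res01 f \<equiv> restrict f {0..<1}"

lemma res01_carrier:
  assumes f: "piso 1 f"
  shows "res01 f \<in> carrier FIET"
proof -
  have "f ` {0..<1} = {0..<1}"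
  proof
    show "f ` {0..<1} \<subseteq> {0..<1}" using piso_maps[OF f] by blast
    show "{0..<1} \<subseteq> f ` {0..<1}"
    proof
      fix y :: real assume y: "y \<in> {0..<1}"
      obtain x where "y = f x" using piso_bij[OF f] by (metis bij_pointE)
      then show "y \<in> f ` {0..<1}" using piso_outside[OF f, of x] y by (cases "x \<in> {0..<1}") auto
    qed
  qed
  moreover have "inj_on f {0..<1}" using piso_bij[OF f] bij_is_inj inj_on_subset by blast
  ultimately have "bij_betw f {0..<1} {0..<1}" by (simp add: bij_betw_def)
  moreover have "bij_betw (res01 f) {0..<1} {0..<1} = bij_betw f {0..<1} {0..<1}"
    by (rule bij_betw_cong) simp
  ultimately have bij: "bij_betw (res01 f) {0..<1} {0..<1}" by simp
  have "pw_iso (res01 f) (breaks f)"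
    unfolding pw_iso_def
  proof (intro allI impI)
    fix x y :: real assume xy: "x \<le> y" "{x..y} \<subseteq> {0..<1} - breaks f"
    then have "{x..y} \<inter> breaks f = {}" by blast
    then obtain e t where e: "\<bar>e\<bar> = 1" "\<And>z. z \<in> {x..y} \<Longrightarrow> f z = e * z + t"
      using no_breaks_affine[OF connected_Icc] by metis
    have "x \<in> {x..y}" "y \<in> {x..y}" using xy(1) by auto
    then have "res01 f x = e * x + t" "res01 f y = e * y + t" using xy(2) e(2) by auto
    then have "res01 f x - res01 f y = e * (x - y)" by (simp add: algebra_simps)
    then show "\<bar>res01 f x - res01 f y\<bar> = y - x" using e(1) xy(1) by (simp add: abs_mult)
  qed
  then have "is_fiet (res01 f)" using pw_iso_imp_is_fiet[OF bij piso_fin[OF f]] by blast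
  then show ?thesis using bij by (simp add: carrier_FIET Bij_def)
qed

lemma isometry_affine:
  fixes f :: "real \<Rightarrow> real"
  assumes "u < v" "\<And>x y. x \<in> {u..v} \<Longrightarrow> y \<in> {u..v} \<Longrightarrow> dist (f x) (f y) = dist x y"
  obtains e t where "\<bar>e\<bar> = 1" "\<And>x. x \<in> {u..v} \<Longrightarrow> f x = e * x + t"
proof -
  have uv: "\<bar>f u - f v\<bar> = v - u"
    using assms(2)[of u v] assms(1) by (simp add: dist_real_def)
  have x: "\<bar>f u - f x\<bar> = x - u" "\<bar>f x - f v\<bar> = v - x" if "x \<in> {u..v}" for x
    using assms(2)[of u x] assms(2)[of x v] assms(1) that by (simp_all add: dist_real_def)
  show thesis
  proof (cases "f u \<le> f v")
    case True
    then have "f x = 1 * x + (f u - u)" if "x \<in> {u..v}" for x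
      using uv x[OF that] by linarith
    then show thesis by (rule that[rotated]) simp_all
  next
    case False
    then have "f x = -1 * x + (f u + u)" if "x \<in> {u..v}" for x
      using uv x[OF that] by linarith
    then show thesis by (rule that[rotated]) simp_all
  qed
qed

lemma FIET_extend:
  assumes g: "g \<in> carrier FIET"
  obtains h where "piso 1 h" "res01 h = g"
proof -
  define h where "h = (\<lambda>x. if x \<in> {0..<1} then g x else x)"
  have bg: "bij_betw g {0..<1} {0..<1}" using bij_FIET[OF g] .
  have "bij_betw h {0..<1} {0..<1}"
    using bg by (subst bij_betw_cong[of _ _ g]) (auto simp: h_def)
  moreover have "bij_betw h (- {0..<1}) (- {0..<1})"
    by (subst bij_betw_cong[of _ _ id]) (auto simp: h_def)
  ultimately have "bij_betw h ({0..<1} \<union> - {0..<1}) ({0..<1} \<union> - {0..<1})"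
    by (rule bij_betw_combine) auto
  then have bij: "bij h" by simp
  have "is_fiet g" using g by (simp add: carrier_FIET)
  then obtain F where F: "finite F" "pw_iso g F" by (rule is_fiet_imp_pw_iso)
  have "liso h x" if x: "x \<notin> F \<union> {0,1}" for x
  proof (cases "x \<in> {0..1}")
    case True
    have "open ({0<..<1} - F)" using F(1) by (intro open_Diff finite_imp_closed) auto
    moreover have "x \<in> {0<..<1} - F" using True x by auto
    ultimately obtain r where r: "r > 0" "\<And>y. \<bar>y - x\<bar> < r \<Longrightarrow> y \<in> {0<..<1} - F"
      using open_real_ball by blast
    have sub: "{x - r/2..x + r/2} \<subseteq> {0<..<1} - F"
    proof
      fix y assume "y \<in> {x - r/2..x + r/2}"
      then have "\<bar>y - x\<bar> < r" using r(1) by (auto simp: abs_if)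
      then show "y \<in> {0<..<1} - F" by (rule r(2))
    qed
    then have sub': "{x - r/2..x + r/2} \<subseteq> {0..<1} - F" by auto
    have "x - r/2 < x + r/2" using r(1) by simp
    then obtain e t where et: "\<bar>e\<bar> = 1" "\<And>y. y \<in> {x - r/2..x + r/2} \<Longrightarrow> g y = e * y + t"
      using isometry_affine[OF _ pw_iso_interval(1)[OF F(2) sub']] by metis
    show ?thesis
    proof (rule liso_intro[OF et(1), of "r/2"])
      fix y assume "\<bar>y - x\<bar> < r / 2"
      then have y: "y \<in> {x - r/2..x + r/2}" by (auto simp: abs_if split: if_splits)
      then have "y \<in> {0..<1}" using sub' by blast
      then show "h y = e * y + t" using et(2)[OF y] by (simp add: h_def)
    qed (use r in auto)
  next
    case False
    then have "x \<in> - {0..1}" "open (- {0..1::real})" by auto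
    then obtain r where r: "r > 0" "\<And>y. \<bar>y - x\<bar> < r \<Longrightarrow> y \<in> - {0..1}"
      using open_real_ball by blast
    show ?thesis
    proof (rule liso_intro[of 1 r _ _ 0])
      fix y assume "\<bar>y - x\<bar> < r"
      from r(2)[OF this] show "h y = 1 * y + 0" by (auto simp: h_def)
    qed (use r(1) in auto)
  qed
  then have "breaks h \<subseteq> F \<union> {0,1}" by (auto simp: breaks_def)
  then have "finite (breaks h)" using F(1) finite_subset by blast
  then have "piso 1 h" using bij by (auto simp: piso_def h_def)
  moreover have "res01 h = g"
    using g by (auto simp: h_def carrier_FIET Bij_def extensional_def fun_eq_iff)
  ultimately show thesis by (rule that)
qed

text \<open>The class of a map of the line in the group of FIETs modulo finite sets.\<close>

definition cls :: "(real \<Rightarrow> real) \<Rightarrow> (real \<Rightarrow> real) set" where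
  "cls f = FIET_null #>\<^bsub>FIET\<^esub> res01 f"

lemma cls_carrier: "piso 1 f \<Longrightarrow> cls f \<in> carrier FIET_bar"
  using res01_carrier by (auto simp: cls_def FIET_bar_def FactGroup_def RCOSETS_def)

lemma cls_mult:
  assumes "piso 1 f" "piso 1 g"
  shows "cls f \<otimes>\<^bsub>FIET_bar\<^esub> cls g = cls (f \<circ> g)"
proof -
  have "compose {0..<1} (res01 f) (res01 g) = res01 (f \<circ> g)"
    using piso_maps[OF assms(2)] by (auto simp: compose_def fun_eq_iff)
  then have "res01 f \<otimes>\<^bsub>FIET\<^esub> res01 g = res01 (f \<circ> g)"
    using assms by (simp add: mult_FIET res01_carrier)
  then show ?thesis
    using normal.rcos_sum[OF normal_FIET_null res01_carrier res01_carrier] assms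
    by (simp add: cls_def FIET_bar_def FactGroup_def)
qed

lemma cls_id: "cls id = \<one>\<^bsub>FIET_bar\<^esub>"
proof -
  interpret group FIET by (rule group_FIET)
  have "res01 id = \<one>\<^bsub>FIET\<^esub>" by (auto simp: one_FIET fun_eq_iff)
  moreover have "FIET_null \<subseteq> carrier FIET" by (auto simp: FIET_null_def)
  ultimately show ?thesis by (simp add: cls_def FIET_bar_def FactGroup_def)
qed

lemma cls_cong:
  assumes "piso 1 f" "piso 1 g" "finite {x. f x \<noteq> g x}"
  shows "cls f = cls g"
proof -
  have "finite {x \<in> {0..<1}. res01 f x \<noteq> res01 g x}"
    by (rule finite_subset[OF _ assms(3)]) auto
  then show ?thesis using assms by (simp add: cls_def rcos_FIET_null_eq_iff res01_carrier)
qed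

lemma cls_comps:
  assumes "\<And>s. s \<in> set ss \<Longrightarrow> piso 1 s"
  shows "foldr (\<otimes>\<^bsub>FIET_bar\<^esub>) (map cls ss) \<one>\<^bsub>FIET_bar\<^esub> = cls (comps ss)"
  using assms
proof (induction ss)
  case (Cons s ss)
  then show ?case using piso_comps[of ss 1] by (simp add: cls_mult o_def)
qed (simp add: cls_id)

lemma (in group) foldr_filter_one:
  assumes "set xs \<subseteq> carrier G"
  shows "foldr (\<otimes>) (filter (\<lambda>x. x \<noteq> \<one>) xs) \<one> = foldr (\<otimes>) xs \<one> \<and> foldr (\<otimes>) xs \<one> \<in> carrier G"
  using assms by (induction xs) auto

theorem corollary2:
  assumes "g \<in> carrier FIET_bar"
  shows "\<exists>ss. length ss \<le> 12 \<and> (\<forall>s\<in>set ss. involution FIET_bar s) \<and>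
           g = foldr (\<otimes>\<^bsub>FIET_bar\<^esub>) ss \<one>\<^bsub>FIET_bar\<^esub>"
proof -
  obtain g0 where g0: "g0 \<in> carrier FIET" "g = FIET_null #>\<^bsub>FIET\<^esub> g0"
    using assms by (auto simp: FIET_bar_def FactGroup_def RCOSETS_def)
  obtain h where h: "piso 1 h" "res01 h = g0" using FIET_extend[OF g0(1)] .
  obtain ts where ts: "length ts = 11" "\<And>s. s \<in> set ts \<Longrightarrow> pinvol 1 s" "finite {x. h x \<noteq> comps ts x}"
    using piso_product_of_involutions[OF h(1)] by blast
  have P: "piso 1 s" if "s \<in> set ts" for s using ts(2)[OF that] by (rule pinvol_piso)
  have "g = cls h" using g0 h by (simp add: cls_def)
  also have "\<dots> = cls (comps ts)" using h(1) piso_comps[OF P] ts(3) by (rule cls_cong)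
  also have "\<dots> = foldr (\<otimes>\<^bsub>FIET_bar\<^esub>) (map cls ts) \<one>\<^bsub>FIET_bar\<^esub>" using cls_comps[OF P] by simp
  finally have g: "g = foldr (\<otimes>\<^bsub>FIET_bar\<^esub>) (map cls ts) \<one>\<^bsub>FIET_bar\<^esub>" .
  define ss where "ss = filter (\<lambda>s. s \<noteq> \<one>\<^bsub>FIET_bar\<^esub>) (map cls ts)"
  have "set (map cls ts) \<subseteq> carrier FIET_bar" using cls_carrier[OF P] by auto
  then have "g = foldr (\<otimes>\<^bsub>FIET_bar\<^esub>) ss \<one>\<^bsub>FIET_bar\<^esub>"
    using group.foldr_filter_one[OF group_FIET_bar] g by (simp add: ss_def)
  moreover have "length ss \<le> length (map cls ts)" unfolding ss_def by (rule length_filter_le)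
  then have "length ss \<le> 12" using ts(1) by simp
  moreover have "involution FIET_bar s" if s: "s \<in> set ss" for s
  proof -
    obtain t where t: "t \<in> set ts" "s = cls t" "s \<noteq> \<one>\<^bsub>FIET_bar\<^esub>" using s by (auto simp: ss_def)
    have "s \<otimes>\<^bsub>FIET_bar\<^esub> s = cls (t \<circ> t)" using t P by (simp add: cls_mult)
    also have "\<dots> = \<one>\<^bsub>FIET_bar\<^esub>" using pinvol_comp_self[OF ts(2)[OF t(1)]] by (simp add: cls_id)
    finally show ?thesis using t cls_carrier[OF P[OF t(1)]] by (simp add: involution_def)
  qed
  ultimately show ?thesis by blast
qed

end
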